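(* Let $\mathcal{T}=(\mathcal{C},\mathcal{S})$ be a consistent junction tree of a discrete Bayesian network $\mathcal{N}=(\mathcal{X},\mathcal{G},\mathcal{P})$ with evidence $\epsilon$, i.e. the two-phase message passing of Lazy AR Propagation has been completed in $\mathcal{T}$. Let $A,B\in\mathcal{C}$ be cliques and let $X\in\mathcal{X}$ be a variable with $X\notin A$ and $X\in B$. Then variable propagation of $X$ from clique $B$ to clique $A$ results in $\pi^*_{A\cup\{X\}}$, the joint potential over $A\cup\{X\}$, as the clique potential of $A$.
   Context: **Bayesian network.** $\mathcal{N}=(\mathcal{X},\mathcal{G},\mathcal{P})$ consists of a finite set $\mathcal{X}$ of discrete variables, an acyclic directed graph $\mathcal{G}$ whose vertices correspond to the variables, and conditional probability distributions (CPDs) $\mathcal{P}=\{\Theta_{Y\mid\pi(Y)}:Y\in\mathcal{X}\}$, where $\pi(Y)$ is the set of parents of $Y$ and $\mathrm{fa}(Y)=\pi(Y)\cup\{Y\}$. The joint distribution is $P(\mathcal{X})=\prod_{Y\in\mathcal{X}}\Theta_{Y\mid\pi(Y)}$. **Evidence.** Hard evidence $\epsilon$ fixes $Y=y$ for each observed variable $Y$. Every variable $Y$ has an evidence function $f(Y)$: if $Y$ is observed to be $y$, then $f(y)=1$ and $f(y')=0$ for $y'\neq y$; if $Y$ is not observed, $f$ is uniform, $f(y)=1/|Y|$ for every state $y$, where $|Y|$ is the number of states of $Y$. Applying $f(Y)$ for an observed $Y$ to a function $\phi$ with $Y$ in its domain means instantiating $\phi$ to $Y=y$, which removes $Y$ from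 its domain. **Potentials.** A potential on $W\subseteq\mathcal{X}$ is $\pi_W=(\Phi)$, where $\Phi$ is a set of non-negative real functions on subsets of $W$. Combination is $(\Phi_1)\otimes(\Phi_2)=(\Phi_1\cup\Phi_2)$. Contraction is $c((\Phi))=\prod_{\phi\in\Phi}\phi$, with $c((\emptyset))=1$. A probability potential $\phi(H\mid T)$ is a non-negative function with head $H$, tail $T$ and domain $H\cup T$. **Junction tree and initialization.** $\mathcal{T}$ is a tree whose nodes are the cliques $\mathcal{C}$ (subsets of $\mathcal{X}$), such that each $\mathrm{fa}(Y)$ is contained in some clique and, for any two cliques, their intersection is contained in every clique on the path between them; the separators $\mathcal{S}$ are the intersections of adjacent cliques, and $\mathrm{adj}(C)$ is the set of cliques adjacent to $C$. Each CPD $\Theta_{Y\mid\pi(Y)}$ is assigned to a clique containing $\mathrm{fa}(Y)$; $\pi_C$ is the potential consisting of the CPDs assigned to $C$. The evidence function $f(Y)$ of every variable $Y$ (observed or not) is assigned to every clique containing $Y$; $\pi_{\epsilon_C}$ is the potential consisting of the evidence functions of all variables of $C$. **Messages.** The message from $C$ to an adjacent clique $D$ is $$\pi_{C\to D}=\Big(\pi_C\otimes\pi_{\epsilon_C}\otimes\bigotimes_{E\in\mathrm{adj}(C)\setminus\{D\}}\pi_{E\to C}\Big)^{\downarrow D},$$ where the projection $\downarrow D$ is computed on the set $\Phi$ of functions of the combined potential as follows: (i) remove the potentials of barren variables, i.e. of unobserved variables outside $D$ which occur in the tail of no probability potential other than those of barren variables; (ii) for each observed $Y\in C$, apply $f(Y)$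 to the functions in $\Phi$; (iii) eliminate each variable not in the separator $C\cap D$ by a sequence of arc-reversals and barren variable eliminations. Reversing the arc from $Y$ to $V$ replaces $\phi(Y\mid T)$ and $\phi(V\mid T')$, $Y\in T'$, by $\phi(V\mid T'')=\sum_Y\phi(Y\mid T)\phi(V\mid T')$ with $T''=(T\cup T')\setminus\{Y\}$, and $\phi(Y\mid T''\cup\{V\})=\phi(Y\mid T)\phi(V\mid T')/\phi(V\mid T'')$. Each probability potential in a message has one head variable (possibly instantiated by evidence). No potential is discarded on the grounds of being separated from $D$ by $\epsilon$, so all evidence is propagated. **Clique potentials after message passing.** Messages are passed in two phases (collect to, then distribute from, a root clique). Afterwards the clique potential of each clique $C$ is $$\pi_C^*=\pi_C\otimes\pi_{\epsilon_C}\otimes\bigotimes_{E\in\mathrm{adj}(C)}\pi_{E\to C},$$ and the joint probability distribution $P(C,\epsilon)$ is obtained as its contraction $c(\pi_C^* )$. Analogously, $\pi^*_{A\cup\{X\}}$ denotes the joint potential over $A\cup\{X\}$, from which the joint probability distribution $P(A\cup\{X\},\epsilon)$ is obtained by contraction. **Variable propagation.** Variable propagation of $X$ from $B$ to $A$ (collecting $X$ from $B$ to $A$) consists of recomputing the messages passed along the path from $B$ to $A$ in $\mathcal{T}$ without eliminating $X$ in the process; the clique potential of a clique on the path is then formed using the recomputed messages in place of the old ones.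
   Formalization: The contraction of the resulting clique potential is shown to equal P(A∪{X},ε) times the constant product of 1/|Y| over unobserved Y in A∪{X}; without this factor the equality fails, since the uniform evidence functions are members of the clique potential. *)

theory Defs
  imports "HOL-Library.FuncSet" Complex_Main
begin

text \<open>
  Real functions of the variables in a set \<open>S\<close> are represented as functions of a total
  configuration \<open>'v \<Rightarrow> 's\<close> that depend only on the coordinates in \<open>S\<close>.
\<close>

definition depends_only_on :: "'v set \<Rightarrow> (('v \<Rightarrow> 's) \<Rightarrow> real) \<Rightarrow> bool" where
  "depends_only_on S g \<longleftrightarrow> (\<forall>w w'. (\<forall>Z\<in>S. w Z = w' Z) \<longrightarrow> g w = g w')"

subsection \<open>Bayesian networks and evidence\<close>

record ('v, 's) bayes_net =
  variables :: "'v set"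
  states :: "'v \<Rightarrow> 's set"
  arcs :: "('v \<times> 'v) set"
  cpd :: "'v \<Rightarrow> ('v \<Rightarrow> 's) \<Rightarrow> real"

definition parents :: "('v, 's) bayes_net \<Rightarrow> 'v \<Rightarrow> 'v set" where
  "parents N Y = {Z. (Z, Y) \<in> arcs N}"

definition family :: "('v, 's) bayes_net \<Rightarrow> 'v \<Rightarrow> 'v set" where
  "family N Y = insert Y (parents N Y)"

text \<open>Coordinates outside \<open>variables N\<close> are unconstrained and never looked at.\<close>

definition configs :: "('v, 's) bayes_net \<Rightarrow> ('v \<Rightarrow> 's) set" where
  "configs N = {w. \<forall>Y\<in>variables N. w Y \<in> states N Y}"

definition bayesian_network :: "('v, 's) bayes_net \<Rightarrow> bool" where
  "bayesian_network N \<longleftrightarrow>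
     finite (variables N) \<and>
     (\<forall>Y\<in>variables N. finite (states N Y) \<and> states N Y \<noteq> {}) \<and>
     arcs N \<subseteq> variables N \<times> variables N \<and> acyclic (arcs N) \<and>
     (\<forall>Y\<in>variables N.
        depends_only_on (family N Y) (cpd N Y) \<and>
        (\<forall>w\<in>configs N. cpd N Y w \<ge> 0 \<and> (\<Sum>s\<in>states N Y. cpd N Y (w(Y := s))) = 1))"

definition joint :: "('v, 's) bayes_net \<Rightarrow> ('v \<Rightarrow> 's) \<Rightarrow> real" where
  "joint N w = (\<Prod>Y\<in>variables N. cpd N Y w)"

text \<open>Hard evidence: \<open>\<epsilon> Y = Some y\<close> means that \<open>Y\<close> is observed to be \<open>y\<close>.\<close>

definition hard_evidence :: "('v, 's) bayes_net \<Rightarrow> ('v \<rightharpoonup> 's) \<Rightarrow> bool" where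
  "hard_evidence N \<epsilon> \<longleftrightarrow>
     dom \<epsilon> \<subseteq> variables N \<and> (\<forall>Y y. \<epsilon> Y = Some y \<longrightarrow> y \<in> states N Y)"

definition evidence_function ::
  "('v, 's) bayes_net \<Rightarrow> ('v \<rightharpoonup> 's) \<Rightarrow> 'v \<Rightarrow> ('v \<Rightarrow> 's) \<Rightarrow> real" where
  "evidence_function N \<epsilon> Y w =
     (case \<epsilon> Y of Some y \<Rightarrow> (if w Y = y then 1 else 0) | None \<Rightarrow> 1 / real (card (states N Y)))"

text \<open>The joint probability \<open>P(W = w, \<epsilon>)\<close>; it is \<open>0\<close> if \<open>w\<close> contradicts the evidence on \<open>W\<close>.\<close>

definition joint_prob ::
  "('v, 's) bayes_net \<Rightarrow> ('v \<rightharpoonup> 's) \<Rightarrow> 'v set \<Rightarrow> ('v \<Rightarrow> 's) \<Rightarrow> real" where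
  "joint_prob N \<epsilon> W w =
     (\<Sum>v\<in>{v \<in> Pi\<^sub>E (variables N) (states N).
            (\<forall>Y\<in>W. v Y = w Y) \<and> (\<forall>Y y. \<epsilon> Y = Some y \<longrightarrow> v Y = y)}. joint N v)"

subsection \<open>Potentials\<close>

text \<open>
  \<open>Prob Y H T g\<close> is the probability potential \<open>g(H | T)\<close> of the variable \<open>Y\<close>: its head \<open>H\<close> is
  \<open>{Y}\<close>, or \<open>{}\<close> once \<open>Y\<close> has been instantiated by evidence.  The name \<open>Y\<close> is kept so that
  potentials of different variables that happen to be the same function after instantiation
  are not identified when sets of potentials are united.  \<open>Evid Y g\<close> is the evidence
  function of \<open>Y\<close>.
\<close>

datatype ('v, 's) factor =
    Prob 'v "'v set" "'v set" "('v \<Rightarrow> 's) \<Rightarrow> real"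
  | Evid 'v "('v \<Rightarrow> 's) \<Rightarrow> real"

fun owner :: "('v, 's) factor \<Rightarrow> 'v" where
  "owner (Prob Y H T g) = Y"
| "owner (Evid Y g) = Y"

fun tail :: "('v, 's) factor \<Rightarrow> 'v set" where
  "tail (Prob Y H T g) = T"
| "tail (Evid Y g) = {}"

fun domain :: "('v, 's) factor \<Rightarrow> 'v set" where
  "domain (Prob Y H T g) = H \<union> T"
| "domain (Evid Y g) = {Y}"

fun val :: "('v, 's) factor \<Rightarrow> ('v \<Rightarrow> 's) \<Rightarrow> real" where
  "val (Prob Y H T g) = g"
| "val (Evid Y g) = g"

type_synonym ('v, 's) potential = "('v, 's) factor set"

definition potential_on :: "('v, 's) bayes_net \<Rightarrow> 'v set \<Rightarrow> ('v, 's) potential \<Rightarrow> bool" where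
  "potential_on N W \<Phi> \<longleftrightarrow>
     finite \<Phi> \<and>
     (\<forall>\<phi>\<in>\<Phi>. domain \<phi> \<subseteq> W \<and> depends_only_on (domain \<phi>) (val \<phi>) \<and>
        (\<forall>w\<in>configs N. val \<phi> w \<ge> 0))"

definition contraction :: "('v, 's) potential \<Rightarrow> ('v \<Rightarrow> 's) \<Rightarrow> real" where
  "contraction \<Phi> w = (\<Prod>\<phi>\<in>\<Phi>. val \<phi> w)"

text \<open>
  \<open>\<Phi>\<close> is a joint potential over \<open>W\<close>: its contraction is \<open>P(W, \<epsilon>)\<close>, up to the constant
  contributed by the uniform evidence functions \<open>1/|Y|\<close> of the unobserved variables of \<open>W\<close>,
  which are members of the clique potentials and hence factors of their contractions.
\<close>

definition joint_potential ::
  "('v, 's) bayes_net \<Rightarrow> ('v \<rightharpoonup> 's) \<Rightarrow> 'v set \<Rightarrow> ('v, 's) potential \<Rightarrow> bool" where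
  "joint_potential N \<epsilon> W \<Phi> \<longleftrightarrow>
     potential_on N W \<Phi> \<and>
     (\<forall>w\<in>configs N. contraction \<Phi> w =
        joint_prob N \<epsilon> W w * (\<Prod>Y\<in>{Y \<in> W. \<epsilon> Y = None}. 1 / real (card (states N Y))))"

subsection \<open>Junction trees\<close>

text \<open>\<open>links\<close> is the (symmetric) adjacency relation; \<open>home Y\<close> is the clique to which the
  CPD of \<open>Y\<close> is assigned.\<close>

record 'v jtree =
  cliques :: "'v set set"
  links :: "('v set \<times> 'v set) set"
  home :: "'v \<Rightarrow> 'v set"

definition clique_path :: "'v jtree \<Rightarrow> 'v set \<Rightarrow> 'v set list \<Rightarrow> 'v set \<Rightarrow> bool" where
  "clique_path J C p D \<longleftrightarrow>
     p \<noteq> [] \<and> hd p = C \<and> last p = D \<and> distinct p \<and> set p \<subseteq> cliques J \<and>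
     successively (\<lambda>E F. (E, F) \<in> links J) p"

definition is_tree :: "'v jtree \<Rightarrow> bool" where
  "is_tree J \<longleftrightarrow>
     links J \<subseteq> cliques J \<times> cliques J \<and> sym (links J) \<and> irrefl (links J) \<and>
     (\<forall>C\<in>cliques J. \<forall>D\<in>cliques J. \<exists>!p. clique_path J C p D)"

definition junction_tree :: "('v, 's) bayes_net \<Rightarrow> 'v jtree \<Rightarrow> bool" where
  "junction_tree N J \<longleftrightarrow>
     (\<forall>C\<in>cliques J. C \<subseteq> variables N) \<and> is_tree J \<and>
     (\<forall>C D p E. clique_path J C p D \<and> E \<in> set p \<longrightarrow> C \<inter> D \<subseteq> E) \<and>
     (\<forall>Y\<in>variables N. home J Y \<in> cliques J \<and> family N Y \<subseteq> home J Y)"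

definition adj :: "'v jtree \<Rightarrow> 'v set \<Rightarrow> 'v set set" where
  "adj J C = {E. (C, E) \<in> links J}"

definition cpd_potential ::
  "('v, 's) bayes_net \<Rightarrow> 'v jtree \<Rightarrow> 'v set \<Rightarrow> ('v, 's) potential" where
  "cpd_potential N J C =
     {Prob Y {Y} (parents N Y) (cpd N Y) |Y. Y \<in> variables N \<and> home J Y = C}"

definition evidence_potential ::
  "('v, 's) bayes_net \<Rightarrow> ('v \<rightharpoonup> 's) \<Rightarrow> 'v set \<Rightarrow> ('v, 's) potential" where
  "evidence_potential N \<epsilon> C = {Evid Y (evidence_function N \<epsilon> Y) |Y. Y \<in> C}"

subsection \<open>Projection by arc-reversal\<close>

text \<open>
  The variables of \<open>K\<close> are to be kept.  The condition on barren variables is recursive;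
  the union below is its greatest solution.
\<close>

definition barren :: "('v \<rightharpoonup> 's) \<Rightarrow> 'v set \<Rightarrow> ('v, 's) potential \<Rightarrow> 'v set" where
  "barren \<epsilon> K \<Phi> =
     \<Union>{S. (\<forall>Y\<in>S. Y \<notin> K \<and> \<epsilon> Y = None) \<and> (\<forall>\<phi>\<in>\<Phi>. owner \<phi> \<notin> S \<longrightarrow> tail \<phi> \<inter> S = {})}"

definition remove_barren ::
  "('v \<rightharpoonup> 's) \<Rightarrow> 'v set \<Rightarrow> ('v, 's) potential \<Rightarrow> ('v, 's) potential" where
  "remove_barren \<epsilon> K \<Phi> = {\<phi> \<in> \<Phi>. owner \<phi> \<notin> barren \<epsilon> K \<Phi>}"

text \<open>
  All observed variables of \<open>C\<close> are instantiated at once.  An evidence function is what is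
  applied to the other functions; it is not applied to itself.
\<close>

fun apply_evidence :: "('v \<rightharpoonup> 's) \<Rightarrow> 'v set \<Rightarrow> ('v, 's) factor \<Rightarrow> ('v, 's) factor" where
  "apply_evidence \<epsilon> C (Prob Y H T g) =
     Prob Y (H - (C \<inter> dom \<epsilon>)) (T - (C \<inter> dom \<epsilon>))
       (\<lambda>w. g (\<lambda>Z. if Z \<in> C \<inter> dom \<epsilon> then the (\<epsilon> Z) else w Z))"
| "apply_evidence \<epsilon> C (Evid Y g) = Evid Y g"

text \<open>
  One step of the elimination of the variables outside \<open>K\<close>.  In an arc-reversal, division by
  \<open>0\<close> yields \<open>0\<close>.  If \<open>V\<close> has been instantiated, its head \<open>H\<close> is empty and \<open>V\<close> does
  not enter the new tail of \<open>Y\<close>.  Once evidence has been applied, all that is left of an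
  observed variable is its evidence function; it is discarded by \<open>absorbed\<close>.
\<close>

inductive elim_step ::
  "('v, 's) bayes_net \<Rightarrow> ('v \<rightharpoonup> 's) \<Rightarrow> 'v set \<Rightarrow> ('v, 's) potential \<Rightarrow> ('v, 's) potential \<Rightarrow> bool"
  for N \<epsilon> K where
  arc_reversal:
    "\<lbrakk> Prob Y {Y} T g \<in> \<Phi>; Prob V H T' h \<in> \<Phi>; Y \<noteq> V; Y \<in> T'; Y \<notin> K;
       T'' = (T \<union> T') - {Y};
       k = (\<lambda>w. \<Sum>s\<in>states N Y. g (w(Y := s)) * h (w(Y := s))) \<rbrakk> \<Longrightarrow>
     elim_step N \<epsilon> K \<Phi>
       ((\<Phi> - {Prob Y {Y} T g, Prob V H T' h}) \<union>
        {Prob V H T'' k, Prob Y {Y} (T'' \<union> H) (\<lambda>w. g w * h w / k w)})"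
| barren_elimination:
    "\<lbrakk> Y \<notin> K; \<epsilon> Y = None; \<forall>\<phi>\<in>\<Phi>. owner \<phi> \<noteq> Y \<longrightarrow> Y \<notin> tail \<phi> \<rbrakk> \<Longrightarrow>
     elim_step N \<epsilon> K \<Phi> {\<phi> \<in> \<Phi>. owner \<phi> \<noteq> Y}"
| absorbed:
    "\<lbrakk> Y \<notin> K; \<epsilon> Y \<noteq> None \<rbrakk> \<Longrightarrow>
     elim_step N \<epsilon> K \<Phi> (\<Phi> - {Evid Y (evidence_function N \<epsilon> Y)})"

text \<open>
  \<open>projection N \<epsilon> C D R \<Phi> \<Phi>'\<close>: \<open>\<Phi>'\<close> is a possible result of projecting \<open>\<Phi>\<close>, a potential
  at \<open>C\<close>, to the adjacent clique \<open>D\<close> without eliminating the variables of \<open>R\<close>.  The result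
  depends on the order of the eliminations and arc-reversals.
\<close>

definition projection ::
  "('v, 's) bayes_net \<Rightarrow> ('v \<rightharpoonup> 's) \<Rightarrow> 'v set \<Rightarrow> 'v set \<Rightarrow> 'v set \<Rightarrow>
   ('v, 's) potential \<Rightarrow> ('v, 's) potential \<Rightarrow> bool" where
  "projection N \<epsilon> C D R \<Phi> \<Phi>' \<longleftrightarrow>
     (elim_step N \<epsilon> ((C \<inter> D) \<union> R))\<^sup>*\<^sup>* (apply_evidence \<epsilon> C ` remove_barren \<epsilon> (D \<union> R) \<Phi>) \<Phi>' \<and>
     (\<forall>\<phi>\<in>\<Phi>'. domain \<phi> \<subseteq> (C \<inter> D) \<union> R)"

subsection \<open>Message passing\<close>

type_synonym ('v, 's) messages = "'v set \<times> 'v set \<rightharpoonup> ('v, 's) potential"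

definition combined ::
  "('v, 's) bayes_net \<Rightarrow> 'v jtree \<Rightarrow> ('v \<rightharpoonup> 's) \<Rightarrow> ('v, 's) messages \<Rightarrow> 'v set \<Rightarrow> 'v set set \<Rightarrow>
   ('v, 's) potential" where
  "combined N J \<epsilon> M C \<E> =
     cpd_potential N J C \<union> evidence_potential N \<epsilon> C \<union> (\<Union>E\<in>\<E>. the (M (E, C)))"

definition clique_potential ::
  "('v, 's) bayes_net \<Rightarrow> 'v jtree \<Rightarrow> ('v \<rightharpoonup> 's) \<Rightarrow> ('v, 's) messages \<Rightarrow> 'v set \<Rightarrow>
   ('v, 's) potential" where
  "clique_potential N J \<epsilon> M C = combined N J \<epsilon> M C (adj J C)"

definition message ::
  "('v, 's) bayes_net \<Rightarrow> 'v jtree \<Rightarrow> ('v \<rightharpoonup> 's) \<Rightarrow> 'v set \<Rightarrow> ('v, 's) messages \<Rightarrow>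
   'v set \<Rightarrow> 'v set \<Rightarrow> ('v, 's) potential \<Rightarrow> bool" where
  "message N J \<epsilon> R M C D \<Phi> \<longleftrightarrow> projection N \<epsilon> C D R (combined N J \<epsilon> M C (adj J C - {D})) \<Phi>"

text \<open>Messages are sent along the directed links in \<open>L\<close>, each at most once and only when
  all the messages it is computed from are available.\<close>

inductive send_messages ::
  "('v, 's) bayes_net \<Rightarrow> 'v jtree \<Rightarrow> ('v \<rightharpoonup> 's) \<Rightarrow> ('v set \<times> 'v set) set \<Rightarrow>
   ('v, 's) messages \<Rightarrow> ('v, 's) messages \<Rightarrow> bool"
  for N J \<epsilon> L M where
  start: "send_messages N J \<epsilon> L M M"
| send:
    "\<lbrakk> send_messages N J \<epsilon> L M M'; (C, D) \<in> L; M' (C, D) = None;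
       \<forall>E\<in>adj J C - {D}. M' (E, C) \<noteq> None; message N J \<epsilon> {} M' C D \<Phi> \<rbrakk> \<Longrightarrow>
     send_messages N J \<epsilon> L M (M'((C, D) \<mapsto> \<Phi>))"

definition towards :: "'v jtree \<Rightarrow> 'v set \<Rightarrow> ('v set \<times> 'v set) set" where
  "towards J R = {(C, D) \<in> links J. \<exists>p. clique_path J C p R \<and> D \<in> set p}"

text \<open>\<open>M\<close> contains the messages obtained by collecting to and then distributing from some
  root clique.\<close>

definition fully_propagated ::
  "('v, 's) bayes_net \<Rightarrow> 'v jtree \<Rightarrow> ('v \<rightharpoonup> 's) \<Rightarrow> ('v, 's) messages \<Rightarrow> bool" where
  "fully_propagated N J \<epsilon> M \<longleftrightarrow>
     (\<exists>R\<in>cliques J. \<exists>M\<^sub>0.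
        send_messages N J \<epsilon> (towards J R) Map.empty M\<^sub>0 \<and> towards J R \<subseteq> dom M\<^sub>0 \<and>
        send_messages N J \<epsilon> ((towards J R)\<inverse>) M\<^sub>0 M \<and> (towards J R)\<inverse> \<subseteq> dom M)"

text \<open>
  \<open>variable_propagation N J \<epsilon> X p M M'\<close>: recomputing, one after the other, the messages along
  the path \<open>p\<close> without eliminating \<open>X\<close> turns the messages \<open>M\<close> into \<open>M'\<close>.
\<close>

inductive variable_propagation ::
  "('v, 's) bayes_net \<Rightarrow> 'v jtree \<Rightarrow> ('v \<rightharpoonup> 's) \<Rightarrow> 'v \<Rightarrow> 'v set list \<Rightarrow>
   ('v, 's) messages \<Rightarrow> ('v, 's) messages \<Rightarrow> bool"
  for N J \<epsilon> X where
  arrived: "variable_propagation N J \<epsilon> X [C] M M"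
| forward:
    "\<lbrakk> message N J \<epsilon> {X} M C D \<Phi>;
       variable_propagation N J \<epsilon> X (D # p) (M((C, D) \<mapsto> \<Phi>)) M' \<rbrakk> \<Longrightarrow>
     variable_propagation N J \<epsilon> X (C # D # p) M M'"

end

theory Submission
  imports Defs
begin

text \<open>
  Call a set of probability potentials sound if, for every set \<open>U\<close> of owners that contains the
  observed variables and is closed under tails, the product of the potentials owned by \<open>U\<close> is
  \<open>P(U, \<epsilon>)\<close>.  The CPDs of the network are sound, because marginalizing a Bayesian network to an
  ancestral set drops CPDs.  Soundness survives the removal of potentials and arc-reversals:
  after reversing the arc from \<open>Y\<close> to \<open>V\<close>, a closed set contains both or neither of \<open>Y\<close> and \<open>V\<close>,
  in which case nothing changes, or \<open>V\<close> alone, in which case adding \<open>Y\<close> gave a closed set before.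
  This argument needs neither acyclicity nor normalization of the reversed potentials, so
  reversals that create directed cycles and divisions by \<open>0\<close> are harmless.

  Replacing the CPDs of a branch of the junction tree by the message that summarizes it is a
  sequence of such operations on the global set of potentials, hence preserves soundness.  At
  \<open>A\<close> all messages have arrived, the unobserved owners are exactly \<open>A \<union> {X}\<close>, all domains lie in
  \<open>A \<union> {X}\<close>, and soundness for the set of all owners is the claim.  That \<open>X\<close> is retained on
  the way from \<open>B\<close> to \<open>A\<close> follows from the running intersection property: a clique on the path
  that does not contain \<open>X\<close> has the home of \<open>X\<close> on the same side as \<open>B\<close>.
\<close>

section \<open>Sound sets of potentials\<close>

lemma depends_only_onD:
  "depends_only_on S g \<Longrightarrow> (\<And>Z. Z \<in> S \<Longrightarrow> w Z = w' Z) \<Longrightarrow> g w = g w'"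
  unfolding depends_only_on_def by blast

fun is_prob :: "('v, 's) factor \<Rightarrow> bool" where
  "is_prob (Prob Y H T g) = True"
| "is_prob (Evid Y g) = False"

text \<open>Evidence functions are kept out of the products studied here: hard evidence is expressed
  by evaluating at \<open>econfigs\<close>, and the evidence functions enter only when a clique
  potential is contracted.\<close>

definition probs :: "('v, 's) potential \<Rightarrow> ('v, 's) potential" where
  "probs \<Phi> = {\<phi> \<in> \<Phi>. is_prob \<phi>}"

definition owners :: "('v, 's) potential \<Rightarrow> 'v set" where
  "owners \<Phi> = owner ` probs \<Phi>"

definition owned_prod :: "'v set \<Rightarrow> ('v, 's) potential \<Rightarrow> ('v \<Rightarrow> 's) \<Rightarrow> real" where
  "owned_prod U \<Phi> w = (\<Prod>\<phi>\<in>{\<phi> \<in> probs \<Phi>. owner \<phi> \<in> U}. val \<phi> w)"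

lemma probs_simps [simp]:
  "probs {} = {}"
  "probs (insert \<phi> \<Phi>) = (if is_prob \<phi> then insert \<phi> (probs \<Phi>) else probs \<Phi>)"
  "probs (\<Phi> \<union> \<Psi>) = probs \<Phi> \<union> probs \<Psi>"
  "probs (\<Union>\<F>) = (\<Union>\<Phi>\<in>\<F>. probs \<Phi>)"
  by (auto simp: probs_def)

lemma owners_simps [simp]:
  "owners {} = {}"
  "owners (insert \<phi> \<Phi>) = (if is_prob \<phi> then insert (owner \<phi>) (owners \<Phi>) else owners \<Phi>)"
  "owners (\<Phi> \<union> \<Psi>) = owners \<Phi> \<union> owners \<Psi>"
  "owners (\<Union>\<F>) = (\<Union>\<Phi>\<in>\<F>. owners \<Phi>)"
  by (auto simp: owners_def)

lemma owners_mono: "\<Phi> \<subseteq> \<Psi> \<Longrightarrow> owners \<Phi> \<subseteq> owners \<Psi>"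
  by (auto simp: owners_def probs_def)

lemma owned_prod_insert:
  assumes "finite \<Phi>" "\<phi> \<notin> \<Phi>" "is_prob \<phi>"
  shows "owned_prod U (insert \<phi> \<Phi>) w =
    (if owner \<phi> \<in> U then val \<phi> w else 1) * owned_prod U \<Phi> w"
proof -
  have fin: "finite {\<psi> \<in> probs \<Phi>. owner \<psi> \<in> U}"
    using assms(1) by (auto simp: probs_def)
  have nin: "\<phi> \<notin> {\<psi> \<in> probs \<Phi>. owner \<psi> \<in> U}"
    using assms(2) by (auto simp: probs_def)
  have "{\<psi> \<in> probs (insert \<phi> \<Phi>). owner \<psi> \<in> U} =
      (if owner \<phi> \<in> U then insert \<phi> {\<psi> \<in> probs \<Phi>. owner \<psi> \<in> U}
       else {\<psi> \<in> probs \<Phi>. owner \<psi> \<in> U})"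
    using assms(3) by auto
  then show ?thesis
    using prod.insert[OF fin nin, of "\<lambda>\<psi>. val \<psi> w"] by (simp add: owned_prod_def del: probs_simps)
qed

locale evidence_network =
  fixes N :: "('v, 's) bayes_net" and \<epsilon> :: "'v \<rightharpoonup> 's"
  assumes bn: "bayesian_network N" and ev: "hard_evidence N \<epsilon>"
begin

definition econfigs :: "('v \<Rightarrow> 's) set" where
  "econfigs = {w \<in> configs N. \<forall>Y y. \<epsilon> Y = Some y \<longrightarrow> w Y = y}"

fun wf_factor :: "('v, 's) factor \<Rightarrow> bool" where
  "wf_factor (Prob Y H T g) \<longleftrightarrow>
     Y \<in> variables N \<and> (H = {Y} \<or> H = {} \<and> Y \<in> dom \<epsilon>) \<and> depends_only_on (H \<union> T) g \<and>
     (\<forall>w\<in>configs N. 0 \<le> g w)"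
| "wf_factor (Evid Y g) \<longleftrightarrow> g = evidence_function N \<epsilon> Y"

text \<open>Injectivity of \<open>owner\<close> leaves each variable at most one probability
  potential, so \<open>owned_prod\<close> has at most one factor per member of
  \<open>U\<close>.\<close>

definition wf_potential :: "('v, 's) potential \<Rightarrow> bool" where
  "wf_potential \<Phi> \<longleftrightarrow> finite \<Phi> \<and> (\<forall>\<phi>\<in>\<Phi>. wf_factor \<phi>) \<and> inj_on owner (probs \<Phi>)"

text \<open>Observed variables are demanded explicitly: instantiation deletes them from tails, after
  which closure under tails would no longer force them into \<open>U\<close>.\<close>

definition ancestral :: "('v, 's) potential \<Rightarrow> 'v set \<Rightarrow> bool" where
  "ancestral \<Phi> U \<longleftrightarrow>
     dom \<epsilon> \<subseteq> U \<and> U \<subseteq> owners \<Phi> \<and> (\<forall>\<phi>\<in>probs \<Phi>. owner \<phi> \<in> U \<longrightarrow> tail \<phi> \<subseteq> U)"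

definition sound :: "('v, 's) potential \<Rightarrow> bool" where
  "sound \<Phi> \<longleftrightarrow>
     (\<forall>U. ancestral \<Phi> U \<longrightarrow> (\<forall>w\<in>econfigs. owned_prod U \<Phi> w = joint_prob N \<epsilon> U w))"

lemma fin_vars: "finite (variables N)"
  and fin_states: "Y \<in> variables N \<Longrightarrow> finite (states N Y)"
  using bn by (auto simp: bayesian_network_def)

lemma configs_upd: "w \<in> configs N \<Longrightarrow> s \<in> states N Y \<Longrightarrow> w(Y := s) \<in> configs N"
  by (auto simp: configs_def)

lemma econfigs_upd: "w \<in> econfigs \<Longrightarrow> s \<in> states N Y \<Longrightarrow> \<epsilon> Y = None \<Longrightarrow> w(Y := s) \<in> econfigs"
  by (auto simp: econfigs_def configs_upd)

text \<open>Marginalization: the completions of \<open>w\<close> are grouped by their value at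
  \<open>Y\<close>. For an observed \<open>Y\<close>, all states but the observed one contribute
  empty sums.\<close>

lemma joint_prob_sum:
  assumes "Y \<in> variables N" "Y \<notin> U"
  shows "joint_prob N \<epsilon> U w = (\<Sum>s\<in>states N Y. joint_prob N \<epsilon> (insert Y U) (w(Y := s)))"
proof -
  let ?A = "{v \<in> Pi\<^sub>E (variables N) (states N).
            (\<forall>Y\<in>U. v Y = w Y) \<and> (\<forall>Y y. \<epsilon> Y = Some y \<longrightarrow> v Y = y)}"
  have fin: "finite ?A"
    by (rule finite_subset[of _ "Pi\<^sub>E (variables N) (states N)"])
      (auto intro!: finite_PiE fin_vars fin_states)
  have "{v \<in> Pi\<^sub>E (variables N) (states N).
      (\<forall>Z\<in>insert Y U. v Z = (w(Y := s)) Z) \<and> (\<forall>Y y. \<epsilon> Y = Some y \<longrightarrow> v Y = y)}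
      = {v \<in> ?A. v Y = s}" for s
    using assms(2) by auto
  then have "(\<Sum>s\<in>states N Y. joint_prob N \<epsilon> (insert Y U) (w(Y := s))) =
      (\<Sum>s\<in>states N Y. \<Sum>v\<in>{v \<in> ?A. v Y = s}. joint N v)"
    by (simp add: joint_prob_def)
  also have "\<dots> = (\<Sum>v\<in>?A. joint N v)"
    by (rule sum.group[OF fin fin_states[OF assms(1)]]) (use assms(1) in auto)
  finally show ?thesis
    by (simp add: joint_prob_def)
qed

lemma wf_depends:
  assumes "wf_factor \<phi>"
  shows "depends_only_on (domain \<phi>) (val \<phi>)"
proof (cases \<phi>)
  case (Evid Y g)
  then show ?thesis
    using assms by (auto simp: depends_only_on_def evidence_function_def split: option.split)
qed (use assms in auto)

lemma wf_nonneg: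
  assumes "wf_factor \<phi>" "w \<in> configs N"
  shows "0 \<le> val \<phi> w"
proof (cases \<phi>)
  case (Evid Y g)
  then show ?thesis
    using assms by (auto simp: evidence_function_def split: option.split)
qed (use assms in auto)

lemma wf_potential_subset: "wf_potential \<Phi> \<Longrightarrow> \<Psi> \<subseteq> \<Phi> \<Longrightarrow> wf_potential \<Psi>"
  unfolding wf_potential_def
  by (auto simp: probs_def dest: finite_subset intro: inj_on_subset)

lemma wf_potential_Un:
  assumes "wf_potential \<Phi>" "wf_potential \<Psi>" "owners \<Phi> \<inter> owners \<Psi> = {}"
  shows "wf_potential (\<Phi> \<union> \<Psi>)"
proof -
  have "inj_on owner (probs \<Phi> \<union> probs \<Psi>)"
    using assms unfolding wf_potential_def owners_def inj_on_Un by blast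
  then show ?thesis
    using assms by (auto simp: wf_potential_def)
qed

lemma wf_potential_unique:
  "wf_potential \<Phi> \<Longrightarrow> \<phi> \<in> \<Phi> \<Longrightarrow> \<psi> \<in> \<Phi> \<Longrightarrow> is_prob \<phi> \<Longrightarrow> is_prob \<psi> \<Longrightarrow> owner \<phi> = owner \<psi> \<Longrightarrow> \<phi> = \<psi>"
  by (auto simp: wf_potential_def inj_on_def probs_def)

lemma sound_probs_cong:
  assumes "probs \<Phi> = probs \<Psi>" "sound \<Phi>"
  shows "sound \<Psi>"
  using assms by (simp add: sound_def ancestral_def owned_prod_def owners_def)

text \<open>If \<open>U\<close> consists of owners in \<open>\<Psi>\<close>, then by uniqueness of
  owners no potential owned by \<open>U\<close> has been lost. So \<open>U\<close> is also ancestral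
  for \<open>\<Phi>\<close>, with the same product.\<close>

lemma sound_subset:
  assumes wf: "wf_potential \<Phi>" and s: "sound \<Phi>" and sub: "\<Psi> \<subseteq> \<Phi>"
  shows "sound \<Psi>"
  unfolding sound_def
proof (intro allI impI ballI)
  fix U w assume U: "ancestral \<Psi> U" and w: "w \<in> econfigs"
  have eq: "{\<phi> \<in> probs \<Phi>. owner \<phi> \<in> U} = {\<phi> \<in> probs \<Psi>. owner \<phi> \<in> U}"
  proof -
    have "\<phi> \<in> probs \<Psi>" if \<phi>: "\<phi> \<in> probs \<Phi>" "owner \<phi> \<in> U" for \<phi>
    proof -
      obtain \<psi> where "\<psi> \<in> probs \<Psi>" "owner \<psi> = owner \<phi>"
        using U \<phi>(2) by (auto simp: ancestral_def owners_def)
      then show ?thesis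
        using wf_potential_unique[OF wf, of \<phi> \<psi>] \<phi> sub by (auto simp: probs_def)
    qed
    then show ?thesis using sub by (auto simp: probs_def)
  qed
  have "ancestral \<Phi> U"
    using U eq owners_mono[OF sub] unfolding ancestral_def by blast
  then show "owned_prod U \<Psi> w = joint_prob N \<epsilon> U w"
    using s w eq by (auto simp: sound_def owned_prod_def)
qed

lemma depends_marginal:
  fixes g h :: "('v \<Rightarrow> 's) \<Rightarrow> real"
  assumes g: "depends_only_on ({Y} \<union> T) g" and h: "depends_only_on (H \<union> T') h" and "Y \<notin> H"
  shows "depends_only_on (H \<union> (T \<union> T' - {Y}))
    (\<lambda>w. \<Sum>s\<in>A. g (w(Y := s)) * h (w(Y := s)))"
  unfolding depends_only_on_def
proof (intro allI impI sum.cong refl)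
  fix w w' :: "'v \<Rightarrow> 's" and s
  assume eq: "\<forall>Z\<in>H \<union> (T \<union> T' - {Y}). w Z = w' Z"
  have "g (w(Y := s)) = g (w'(Y := s))" by (rule depends_only_onD[OF g]) (use eq in auto)
  moreover have "h (w(Y := s)) = h (w'(Y := s))" by (rule depends_only_onD[OF h]) (use eq in auto)
  ultimately show "g (w(Y := s)) * h (w(Y := s)) = g (w'(Y := s)) * h (w'(Y := s))" by simp
qed

section \<open>Arc-reversal\<close>

context
  fixes \<Phi> :: "('v, 's) potential" and Y V :: 'v and T :: "'v set" and g :: "('v \<Rightarrow> 's) \<Rightarrow> real"
    and H T' :: "'v set" and h :: "('v \<Rightarrow> 's) \<Rightarrow> real"
begin

definition "reversed_tail = (T \<union> T') - {Y}"
definition "marginal = (\<lambda>w. \<Sum>s\<in>states N Y. g (w(Y := s)) * h (w(Y := s)))"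
definition "new_child = Prob V H reversed_tail marginal"
definition "new_parent = Prob Y {Y} (reversed_tail \<union> H) (\<lambda>w. g w * h w / marginal w)"
definition "rest = \<Phi> - {Prob Y {Y} T g, Prob V H T' h}"

context
  assumes wf: "wf_potential \<Phi>"
    and a: "Prob Y {Y} T g \<in> \<Phi>" and b: "Prob V H T' h \<in> \<Phi>" and YV: "Y \<noteq> V"
begin

lemma wf_a: "wf_factor (Prob Y {Y} T g)" and wf_b: "wf_factor (Prob V H T' h)"
  using wf a b by (auto simp: wf_potential_def)

lemma Y_notin_H: "Y \<notin> H"
  using wf_b YV by auto

lemma marginal_nonneg: "w \<in> configs N \<Longrightarrow> 0 \<le> marginal w"
  using wf_a wf_b by (auto simp: marginal_def intro!: sum_nonneg mult_nonneg_nonneg configs_upd)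

lemma marginal_depends: "depends_only_on (H \<union> reversed_tail) marginal"
  using depends_marginal[of Y T g H T' h "states N Y"] wf_a wf_b Y_notin_H
  by (auto simp: marginal_def reversed_tail_def)

lemma wf_new_child: "wf_factor new_child"
  using wf_b marginal_nonneg marginal_depends by (auto simp: new_child_def)

lemma wf_new_parent: "wf_factor new_parent"
proof -
  have "depends_only_on ({Y} \<union> (reversed_tail \<union> H)) (\<lambda>w. g w * h w / marginal w)"
    unfolding depends_only_on_def
  proof (intro allI impI)
    fix w w' :: "'v \<Rightarrow> 's"
    assume eq: "\<forall>Z\<in>{Y} \<union> (reversed_tail \<union> H). w Z = w' Z"
    have "g w = g w'"
      by (rule depends_only_onD[of "{Y} \<union> T"]) (use wf_a eq in \<open>auto simp: reversed_tail_def\<close>)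
    moreover have "h w = h w'"
      by (rule depends_only_onD[of "H \<union> T'"]) (use wf_b eq in \<open>auto simp: reversed_tail_def\<close>)
    moreover have "marginal w = marginal w'"
      by (rule depends_only_onD[OF marginal_depends]) (use eq in auto)
    ultimately show "g w * h w / marginal w = g w' * h w' / marginal w'" by simp
  qed
  then show ?thesis
    using wf_a wf_b marginal_nonneg by (auto simp: new_parent_def)
qed

lemma factors_eq: "\<Phi> = insert (Prob Y {Y} T g) (insert (Prob V H T' h) rest)"
  using a b by (auto simp: rest_def)

lemma probs_eq: "probs \<Phi> = insert (Prob Y {Y} T g) (insert (Prob V H T' h) (probs rest))"
  by (subst factors_eq) simp

lemma owners_eq: "owners \<Phi> = insert Y (insert V (owners rest))"
  by (subst factors_eq) simp

lemma rest_owner: "\<phi> \<in> probs rest \<Longrightarrow> owner \<phi> \<noteq> Y \<and> owner \<phi> \<noteq> V"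
  using wf_potential_unique[OF wf, of \<phi> "Prob Y {Y} T g"]
    wf_potential_unique[OF wf, of \<phi> "Prob V H T' h"] a b
  by (auto simp: rest_def probs_def)

text \<open>Products run over sets of factors; this keeps a factor of the pair, old or new, from
  merging with one in \<open>rest\<close>.\<close>

lemma new_notin_rest: "Prob Y H' T0 g' \<notin> rest" "Prob V H' T0 g' \<notin> rest"
  using rest_owner by (fastforce simp: probs_def)+

lemma wf_reversal: "wf_potential (insert new_child (insert new_parent rest))"
proof -
  have "wf_potential rest"
    by (rule wf_potential_subset[OF wf]) (auto simp: rest_def)
  moreover have "wf_potential {new_child, new_parent}"
    using wf_new_child wf_new_parent YV by (auto simp: wf_potential_def new_child_def new_parent_def)
  moreover have "owners {new_child, new_parent} \<inter> owners rest = {}"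
    using rest_owner by (force simp: owners_def new_child_def new_parent_def)
  ultimately show ?thesis
    using wf_potential_Un[of "{new_child, new_parent}" rest] by simp
qed

lemma owned_prod_old:
  "owned_prod U \<Phi> w =
     (if Y \<in> U then g w else 1) * ((if V \<in> U then h w else 1) * owned_prod U rest w)"
proof -
  have "finite rest" using wf by (auto simp: wf_potential_def rest_def)
  then show ?thesis
    using new_notin_rest YV
    by (subst factors_eq, subst owned_prod_insert, simp, simp, simp, subst owned_prod_insert) auto
qed

lemma owned_prod_new:
  "owned_prod U (insert new_child (insert new_parent rest)) w =
     (if V \<in> U then marginal w else 1) * ((if Y \<in> U then g w * h w / marginal w else 1) * owned_prod U rest w)"
proof -
  have "finite rest" using wf by (auto simp: wf_potential_def rest_def)
  then show ?thesis
    unfolding new_child_def new_parent_def using new_notin_rest YV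
    by (subst owned_prod_insert, simp, simp, simp, subst owned_prod_insert) auto
qed

text \<open>If the marginal vanishes at \<open>w\<close>, it is a vanishing sum of non-negative
  terms, one of which is the product at \<open>w\<close> itself. The value 0 produced by the
  division is therefore the right one.\<close>

lemma reversal_product:
  assumes "w \<in> configs N" and w: "w Y \<in> states N Y"
  shows "marginal w * (g w * h w / marginal w) = g w * h w"
proof (cases "marginal w = 0")
  case True
  have "finite (states N Y)" using wf_a by (auto intro: fin_states)
  moreover have "0 \<le> g (w(Y := s)) * h (w(Y := s))" if "s \<in> states N Y" for s
    using wf_a wf_b that assms by (auto intro!: mult_nonneg_nonneg configs_upd)
  ultimately have "g (w(Y := w Y)) * h (w(Y := w Y)) = 0"
    using True w sum_nonneg_0[of "states N Y" "\<lambda>s. g (w(Y := s)) * h (w(Y := s))" "w Y"]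
    unfolding marginal_def by simp
  then show ?thesis using True by simp
qed simp

lemma sound_reversal:
  assumes s: "sound \<Phi>" and Y: "\<epsilon> Y = None"
  shows "sound (insert new_child (insert new_parent rest))"
  unfolding sound_def
proof (intro allI impI ballI)
  fix U w assume U: "ancestral (insert new_child (insert new_parent rest)) U" and w: "w \<in> econfigs"
  have YN: "Y \<in> variables N" using wf_a by auto
  have wc: "w \<in> configs N" "w Y \<in> states N Y" using w YN by (auto simp: econfigs_def configs_def)
  have own: "owners (insert new_child (insert new_parent rest)) = owners \<Phi>"
    by (auto simp: owners_eq new_child_def new_parent_def)
  have Urest: "\<And>\<phi>. \<phi> \<in> probs rest \<Longrightarrow> owner \<phi> \<in> U \<Longrightarrow> tail \<phi> \<subseteq> U"
    and UV: "V \<in> U \<Longrightarrow> reversed_tail \<subseteq> U" and UY: "Y \<in> U \<Longrightarrow> reversed_tail \<union> H \<subseteq> U"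
    and U0: "dom \<epsilon> \<subseteq> U" "U \<subseteq> owners \<Phi>"
    using U unfolding ancestral_def own by (auto simp: new_child_def new_parent_def)
  \<comment> \<open>If \<open>V\<close> is instantiated, its head is empty, but then it is observed.\<close>
  have VU: "V \<in> U" if "Y \<in> U"
    using UY[OF that] wf_b U0 by auto
  show "owned_prod U (insert new_child (insert new_parent rest)) w = joint_prob N \<epsilon> U w"
  proof (cases "V \<in> U \<and> Y \<notin> U")
    \<comment> \<open>By \<open>VU\<close>, \<open>U\<close> contains both or neither of
      \<open>Y\<close> and \<open>V\<close>; in the former case the two new factors multiply to the
      two old ones.\<close>
    case False
    then have "owned_prod U (insert new_child (insert new_parent rest)) w = owned_prod U \<Phi> w"
      unfolding owned_prod_old owned_prod_new using reversal_product[OF wc] VU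
      by (auto simp: mult.assoc[symmetric])
    moreover have "ancestral \<Phi> U"
      using Urest UV UY U0 False VU unfolding ancestral_def probs_eq owners_eq by (auto simp: reversed_tail_def)
    ultimately show ?thesis using s w by (simp add: sound_def)
  next
    case True
    let ?U = "insert Y U"
    \<comment> \<open>Both old tails lie in \<open>reversed_tail\<close> together with
      \<open>Y\<close>, and no potential in \<open>rest\<close> is owned by
      \<open>Y\<close>.\<close>
    have anc: "ancestral \<Phi> ?U"
      using Urest UV U0 True rest_owner unfolding ancestral_def probs_eq owners_eq by (auto simp: reversed_tail_def)
    \<comment> \<open>The factors of \<open>rest\<close> owned by \<open>U\<close> have their tails
      in \<open>U\<close>, which misses \<open>Y\<close>, so they can be pulled out of the sum over
      the states of \<open>Y\<close>.\<close>
    have rest: "owned_prod ?U rest (w(Y := s)) = owned_prod U rest w" for s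
      unfolding owned_prod_def
    proof (rule prod.cong)
      show "{\<phi> \<in> probs rest. owner \<phi> \<in> ?U} = {\<phi> \<in> probs rest. owner \<phi> \<in> U}"
        using rest_owner by auto
    next
      fix \<phi> assume "\<phi> \<in> {\<phi> \<in> probs rest. owner \<phi> \<in> U}"
      then have \<phi>: "\<phi> \<in> probs rest" "owner \<phi> \<in> U" by auto
      obtain Z H' T0 g' where \<phi>eq: "\<phi> = Prob Z H' T0 g'"
        using \<phi>(1) by (cases \<phi>) (auto simp: probs_def)
      have wf\<phi>: "wf_factor \<phi>"
        using \<phi>(1) wf by (auto simp: probs_def rest_def wf_potential_def)
      have "Y \<notin> domain \<phi>"
        using Urest[OF \<phi>] True wf\<phi> rest_owner[OF \<phi>(1)] by (auto simp: \<phi>eq)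
      then show "val \<phi> (w(Y := s)) = val \<phi> w"
        by (intro depends_only_onD[OF wf_depends[OF wf\<phi>]]) auto
    qed
    have "joint_prob N \<epsilon> U w = (\<Sum>s\<in>states N Y. joint_prob N \<epsilon> ?U (w(Y := s)))"
      using True YN by (intro joint_prob_sum) auto
    also have "\<dots> = (\<Sum>s\<in>states N Y. owned_prod ?U \<Phi> (w(Y := s)))"
      using anc s econfigs_upd[OF w _ Y] by (intro sum.cong) (auto simp: sound_def)
    also have "\<dots> = (\<Sum>s\<in>states N Y. g (w(Y := s)) * h (w(Y := s))) * owned_prod U rest w"
      unfolding owned_prod_old rest using True by (simp add: sum_distrib_right mult.assoc)
    also have "\<dots> = owned_prod U (insert new_child (insert new_parent rest)) w"
      unfolding owned_prod_new using True by (simp add: marginal_def)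
    finally show ?thesis by simp
  qed
qed

end

end

section \<open>Instantiation by evidence\<close>

lemma apply_evidence_simps [simp]:
  "is_prob (apply_evidence \<epsilon> C \<phi>) = is_prob \<phi>"
  "owner (apply_evidence \<epsilon> C \<phi>) = owner \<phi>"
  "tail (apply_evidence \<epsilon> C \<phi>) = tail \<phi> - C \<inter> dom \<epsilon>"
  by (cases \<phi>; simp)+

lemma owners_apply_evidence [simp]: "owners (apply_evidence \<epsilon> C ` \<Phi>) = owners \<Phi>"
  unfolding owners_def probs_def image_def by (fastforce)

text \<open>Substituting the observed values does nothing to a configuration that already agrees
  with them.\<close>

lemma val_apply_evidence:
  assumes "w \<in> econfigs"
  shows "val (apply_evidence \<epsilon> C \<phi>) w = val \<phi> w"
proof -
  have "(\<lambda>Z. if Z \<in> C \<inter> dom \<epsilon> then the (\<epsilon> Z) else w Z) = w"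
    using assms by (auto simp: econfigs_def fun_eq_iff dom_def)
  then show ?thesis by (cases \<phi>) (simp_all del: Int_iff)
qed

lemma wf_apply_evidence:
  assumes "wf_factor \<phi>"
  shows "wf_factor (apply_evidence \<epsilon> C \<phi>)"
proof (cases \<phi>)
  case (Prob Y H T g)
  let ?f = "\<lambda>w Z. if Z \<in> C \<inter> dom \<epsilon> then the (\<epsilon> Z) else w Z"
  have g: "depends_only_on (H \<union> T) g" and nn: "\<And>w. w \<in> configs N \<Longrightarrow> 0 \<le> g w"
    using assms Prob by auto
  have "depends_only_on ((H - C \<inter> dom \<epsilon>) \<union> (T - C \<inter> dom \<epsilon>)) (\<lambda>w. g (?f w))"
    unfolding depends_only_on_def
    by (intro allI impI depends_only_onD[OF g]) auto
  moreover have "?f w \<in> configs N" if "w \<in> configs N" for w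
    using that ev by (auto simp: configs_def hard_evidence_def)
  ultimately show ?thesis
    using assms Prob nn by (auto simp del: Int_iff)
qed (use assms in simp)

lemma wf_potential_apply_evidence:
  assumes "wf_potential \<Phi>"
  shows "wf_potential (apply_evidence \<epsilon> C ` \<Phi>)"
proof -
  have "inj_on owner (probs (apply_evidence \<epsilon> C ` \<Phi>))"
  proof (rule inj_onI)
    fix \<phi> \<psi> assume "\<phi> \<in> probs (apply_evidence \<epsilon> C ` \<Phi>)" "\<psi> \<in> probs (apply_evidence \<epsilon> C ` \<Phi>)"
      and eq: "owner \<phi> = owner \<psi>"
    then obtain \<phi>' \<psi>' where "\<phi> = apply_evidence \<epsilon> C \<phi>'" "\<psi> = apply_evidence \<epsilon> C \<psi>'"
      "\<phi>' \<in> \<Phi>" "\<psi>' \<in> \<Phi>" "is_prob \<phi>'" "is_prob \<psi>'"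
      by (auto simp: probs_def)
    then show "\<phi> = \<psi>" using eq wf_potential_unique[OF assms, of \<phi>' \<psi>'] by simp
  qed
  then show ?thesis
    using assms by (auto simp: wf_potential_def wf_apply_evidence)
qed

text \<open>Only the potentials at one clique are instantiated; \<open>\<Psi>\<close> is the rest of
  the network. Values at \<open>econfigs\<close> do not change, and the variables deleted from tails
  are observed, hence in every ancestral set.\<close>

lemma sound_apply_evidence:
  assumes wf: "wf_potential (\<Phi> \<union> \<Psi>)" and s: "sound (\<Phi> \<union> \<Psi>)" and dis: "owners \<Phi> \<inter> owners \<Psi> = {}"
  shows "sound (apply_evidence \<epsilon> C ` \<Phi> \<union> \<Psi>)"
  unfolding sound_def
proof (intro allI impI ballI)
  \<comment> \<open>A single map on the union that acts as instantiation on \<open>\<Phi>\<close>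
    and as the identity on \<open>\<Psi>\<close>, told apart by their disjoint owners; the product
    is then reindexed along it.\<close>
  let ?f = "\<lambda>\<phi>. if owner \<phi> \<in> owners \<Phi> then apply_evidence \<epsilon> C \<phi> else \<phi>"
  fix U w assume U: "ancestral (apply_evidence \<epsilon> C ` \<Phi> \<union> \<Psi>) U" and w: "w \<in> econfigs"
  have inj: "inj_on owner (probs (\<Phi> \<union> \<Psi>))" using wf by (simp add: wf_potential_def)
  have p: "probs (apply_evidence \<epsilon> C ` \<Phi> \<union> \<Psi>) = ?f ` probs (\<Phi> \<union> \<Psi>)"
  proof -
    have "?f ` probs \<Phi> = apply_evidence \<epsilon> C ` probs \<Phi>"
      by (rule image_cong) (auto simp: owners_def)
    moreover have "?f ` probs \<Psi> = (\<lambda>x. x) ` probs \<Psi>"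
      by (rule image_cong) (use dis in \<open>auto simp: owners_def\<close>)
    moreover have "probs (apply_evidence \<epsilon> C ` \<Phi>) = apply_evidence \<epsilon> C ` probs \<Phi>"
      by (auto simp: probs_def)
    ultimately show ?thesis by (simp only: image_Un probs_simps image_ident)
  qed
  have "inj_on (owner \<circ> ?f) (probs (\<Phi> \<union> \<Psi>))"
    using inj by (auto simp: inj_on_def)
  then have injf: "inj_on ?f {\<phi> \<in> probs (\<Phi> \<union> \<Psi>). owner \<phi> \<in> U}"
    by (rule inj_on_subset[OF inj_on_imageI2]) auto
  have eqU: "{\<phi> \<in> ?f ` probs (\<Phi> \<union> \<Psi>). owner \<phi> \<in> U} = ?f ` {\<phi> \<in> probs (\<Phi> \<union> \<Psi>). owner \<phi> \<in> U}"
    by (auto split: if_splits)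
  have "owned_prod U (apply_evidence \<epsilon> C ` \<Phi> \<union> \<Psi>) w =
      (\<Prod>\<phi>\<in>{\<phi> \<in> probs (\<Phi> \<union> \<Psi>). owner \<phi> \<in> U}. val (?f \<phi>) w)"
    by (simp only: owned_prod_def p eqU prod.reindex[OF injf] o_def)
  also have "\<dots> = owned_prod U (\<Phi> \<union> \<Psi>) w"
    unfolding owned_prod_def by (rule prod.cong) (auto simp: val_apply_evidence[OF w])
  finally have "owned_prod U (apply_evidence \<epsilon> C ` \<Phi> \<union> \<Psi>) w = owned_prod U (\<Phi> \<union> \<Psi>) w" .
  moreover have "ancestral (\<Phi> \<union> \<Psi>) U"
  proof -
    have dU: "dom \<epsilon> \<subseteq> U" using U by (simp add: ancestral_def)
    have "tail \<phi> \<subseteq> U" if "\<phi> \<in> probs (\<Phi> \<union> \<Psi>)" "owner \<phi> \<in> U" for \<phi>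
    proof -
      have "?f \<phi> \<in> probs (apply_evidence \<epsilon> C ` \<Phi> \<union> \<Psi>)" unfolding p using that by blast
      moreover have "owner (?f \<phi>) \<in> U" using that by simp
      ultimately have "tail (?f \<phi>) \<subseteq> U" using U by (auto simp: ancestral_def simp del: apply_evidence_simps)
      moreover have "tail \<phi> \<subseteq> tail (?f \<phi>) \<union> dom \<epsilon>" by auto
      ultimately show ?thesis using dU by blast
    qed
    then show ?thesis using U by (auto simp: ancestral_def)
  qed
  ultimately show "owned_prod U (apply_evidence \<epsilon> C ` \<Phi> \<union> \<Psi>) w = joint_prob N \<epsilon> U w"
    using s w by (simp add: sound_def)
qed

end

section \<open>Ancestral sets of the network\<close>

definition cpds :: "('v, 's) bayes_net \<Rightarrow> 'v set \<Rightarrow> ('v, 's) potential" where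
  "cpds N W = (\<lambda>Y. Prob Y {Y} (parents N Y) (cpd N Y)) ` W"

lemma probs_cpds [simp]: "probs (cpds N W) = cpds N W"
  by (auto simp: probs_def cpds_def)

lemma owners_cpds [simp]: "owners (cpds N W) = W"
  by (simp add: owners_def) (simp add: cpds_def image_image)

lemma cpds_Un: "cpds N (W \<union> W') = cpds N W \<union> cpds N W'"
  by (auto simp: cpds_def)

context evidence_network
begin

lemma parents_subset: "parents N Y \<subseteq> variables N"
  using bn by (auto simp: bayesian_network_def parents_def)

lemma wf_cpds:
  assumes "W \<subseteq> variables N"
  shows "wf_potential (cpds N W)"
proof -
  have "inj_on owner (cpds N W)"
    by (auto simp: inj_on_def cpds_def)
  moreover have "finite (cpds N W)"
    using assms fin_vars finite_subset by (auto simp: cpds_def)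
  moreover have "wf_factor \<phi>" if "\<phi> \<in> cpds N W" for \<phi>
    using that assms bn by (auto simp: cpds_def bayesian_network_def family_def)
  ultimately show ?thesis
    by (simp add: wf_potential_def)
qed

text \<open>A finite acyclic relation is well-founded, so the variables outside \<open>U\<close>
  include one with no parent outside \<open>U\<close>.\<close>

lemma ex_minimal_variable:
  assumes "U \<subset> variables N"
  obtains Y where "Y \<in> variables N" "Y \<notin> U" "parents N Y \<subseteq> U"
proof -
  have "finite (arcs N)"
    using bn fin_vars by (auto simp: bayesian_network_def intro: finite_subset)
  then have "wf (arcs N)"
    using bn by (auto simp: bayesian_network_def intro: finite_acyclic_wf)
  moreover obtain Z where "Z \<in> variables N - U" using assms by blast
  ultimately obtain Y where Y: "Y \<in> variables N - U" "\<And>Z. (Z, Y) \<in> arcs N \<Longrightarrow> Z \<notin> variables N - U"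
    by (rule wfE_min) blast
  have pU: "parents N Y \<subseteq> U"
    using Y(2) parents_subset[of Y] by (auto simp: parents_def)
  show ?thesis
    by (rule that[OF _ _ pU]) (use Y(1) in auto)
qed

text \<open>Induction on the number of variables missing from \<open>U\<close>: add a variable
  \<open>Y\<close> whose parents are all in \<open>U\<close>, use the claim for the larger set, and
  sum \<open>Y\<close> out again.\<close>

lemma joint_prob_ancestral:
  assumes "U \<subseteq> variables N" "dom \<epsilon> \<subseteq> U" "\<And>Y. Y \<in> U \<Longrightarrow> parents N Y \<subseteq> U" "w \<in> econfigs"
  shows "joint_prob N \<epsilon> U w = (\<Prod>Y\<in>U. cpd N Y w)"
  using assms
proof (induction "card (variables N - U)" arbitrary: U w rule: less_induct)
  case less
  have dep: "depends_only_on (family N Y) (cpd N Y)" if "Y \<in> variables N" for Y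
    using bn that by (simp add: bayesian_network_def)
  show ?case
  proof (cases "U = variables N")
    case True
    \<comment> \<open>With every variable fixed, a single configuration remains. It is a restriction
      because members of \<open>Pi\<^sub>E\<close> are undefined outside the variables.\<close>
    have "{v \<in> Pi\<^sub>E (variables N) (states N).
        (\<forall>Y\<in>U. v Y = w Y) \<and> (\<forall>Y y. \<epsilon> Y = Some y \<longrightarrow> v Y = y)} = {restrict w (variables N)}"
    proof -
      have "\<And>Y y. \<epsilon> Y = Some y \<Longrightarrow> Y \<in> variables N" using ev by (auto simp: hard_evidence_def)
      moreover have "v = restrict w (variables N)"
        if "v \<in> Pi\<^sub>E (variables N) (states N)" "\<forall>Y\<in>variables N. v Y = w Y" for v
      proof
        show "v Y = restrict w (variables N) Y" for Y
          using that(2) PiE_arb[OF that(1)] by (cases "Y \<in> variables N") simp_all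
      qed
      ultimately show ?thesis
        using less.prems(4) True by (auto simp: econfigs_def configs_def)
    qed
    then have "joint_prob N \<epsilon> U w = joint N (restrict w (variables N))"
      by (simp add: joint_prob_def)
    also have "\<dots> = (\<Prod>Y\<in>U. cpd N Y w)"
      unfolding joint_def True
    proof (rule prod.cong)
      fix Y assume Y: "Y \<in> variables N"
      show "cpd N Y (restrict w (variables N)) = cpd N Y w"
        by (rule depends_only_onD[OF dep[OF Y]]) (use Y parents_subset in \<open>auto simp: family_def\<close>)
    qed simp
    finally show ?thesis .
  next
    case False
    then obtain Y where Y: "Y \<in> variables N" "Y \<notin> U" "parents N Y \<subseteq> U"
      using ex_minimal_variable less.prems(1) by blast
    have fU: "finite U" using less.prems(1) fin_vars finite_subset by blast
    have Y\<epsilon>: "\<epsilon> Y = None" using Y less.prems(2) by blast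
    have "joint_prob N \<epsilon> U w = (\<Sum>s\<in>states N Y. joint_prob N \<epsilon> (insert Y U) (w(Y := s)))"
      using Y by (intro joint_prob_sum)
    also have "\<dots> = (\<Sum>s\<in>states N Y. \<Prod>Z\<in>insert Y U. cpd N Z (w(Y := s)))"
    proof (rule sum.cong)
      fix s assume s: "s \<in> states N Y"
      show "joint_prob N \<epsilon> (insert Y U) (w(Y := s)) = (\<Prod>Z\<in>insert Y U. cpd N Z (w(Y := s)))"
      proof (rule less.hyps)
        show "card (variables N - insert Y U) < card (variables N - U)"
          using Y fin_vars by (intro psubset_card_mono) auto
        show "w(Y := s) \<in> econfigs" by (rule econfigs_upd[OF less.prems(4) s Y\<epsilon>])
        show "parents N Z \<subseteq> insert Y U" if "Z \<in> insert Y U" for Z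
          using that Y less.prems(3) by blast
      qed (use Y less.prems in auto)
    qed simp
    also have "\<dots> = (\<Sum>s\<in>states N Y. cpd N Y (w(Y := s)) * (\<Prod>Z\<in>U. cpd N Z w))"
    proof (rule sum.cong)
      fix s
      \<comment> \<open>\<open>Y\<close> is outside \<open>U\<close>, and the CPD of a member of
        \<open>U\<close> depends only on its family, which lies in \<open>U\<close>.\<close>
      have "(\<Prod>Z\<in>U. cpd N Z (w(Y := s))) = (\<Prod>Z\<in>U. cpd N Z w)"
      proof (rule prod.cong)
        fix Z assume Z: "Z \<in> U"
        show "cpd N Z (w(Y := s)) = cpd N Z w"
          by (rule depends_only_onD[OF dep]) (use Z Y less.prems(1) less.prems(3)[OF Z] in \<open>auto simp: family_def\<close>)
      qed simp
      then show "(\<Prod>Z\<in>insert Y U. cpd N Z (w(Y := s))) = cpd N Y (w(Y := s)) * (\<Prod>Z\<in>U. cpd N Z w)"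
        using fU Y by simp
    qed simp
    \<comment> \<open>Here the normalization of the CPD of \<open>Y\<close> enters.\<close>
    also have "\<dots> = (\<Prod>Z\<in>U. cpd N Z w)"
      using bn Y less.prems(4)
      by (simp add: sum_distrib_right[symmetric] bayesian_network_def econfigs_def)
    finally show ?thesis .
  qed
qed

lemma sound_cpds: "sound (cpds N (variables N))"
  unfolding sound_def
proof (intro allI impI ballI)
  fix U w assume U: "ancestral (cpds N (variables N)) U" and w: "w \<in> econfigs"
  have UN: "U \<subseteq> variables N" using U by (simp add: ancestral_def)
  have inj: "inj_on (\<lambda>Y. Prob Y {Y} (parents N Y) (cpd N Y)) U" by (auto simp: inj_on_def)
  have "{\<phi> \<in> probs (cpds N (variables N)). owner \<phi> \<in> U} = (\<lambda>Y. Prob Y {Y} (parents N Y) (cpd N Y)) ` U"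
    unfolding probs_cpds using UN by (auto simp: cpds_def)
  then have "owned_prod U (cpds N (variables N)) w = (\<Prod>Y\<in>U. cpd N Y w)"
    unfolding owned_prod_def using prod.reindex[OF inj, of "\<lambda>\<phi>. val \<phi> w"] by (simp add: o_def)
  moreover have "parents N Y \<subseteq> U" if "Y \<in> U" for Y
  proof -
    have "Prob Y {Y} (parents N Y) (cpd N Y) \<in> probs (cpds N (variables N))"
      unfolding probs_cpds using UN that by (auto simp: cpds_def)
    then show ?thesis using U that by (force simp: ancestral_def)
  qed
  ultimately show "owned_prod U (cpds N (variables N)) w = joint_prob N \<epsilon> U w"
    using joint_prob_ancestral[OF UN _ _ w] U by (simp add: ancestral_def)
qed

section \<open>Projection\<close>

text \<open>\<open>\<Psi>\<close> stands for the potentials elsewhere in the junction tree.\<close>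

definition refines :: "'v set \<Rightarrow> ('v, 's) potential \<Rightarrow> ('v, 's) potential \<Rightarrow> bool" where
  "refines K \<Phi> \<Phi>' \<longleftrightarrow>
     wf_potential \<Phi>' \<and> owners \<Phi>' \<subseteq> owners \<Phi> \<and> owners \<Phi> \<inter> (K \<union> dom \<epsilon>) \<subseteq> owners \<Phi>' \<and>
     (\<forall>Y\<in>K. \<forall>g. Evid Y g \<in> \<Phi> \<longrightarrow> Evid Y g \<in> \<Phi>') \<and>
     (\<forall>\<Psi>. wf_potential \<Psi> \<longrightarrow> owners \<Phi> \<inter> owners \<Psi> = {} \<longrightarrow> sound (\<Phi> \<union> \<Psi>) \<longrightarrow> sound (\<Phi>' \<union> \<Psi>))"

lemma refinesD:
  assumes "refines K \<Phi> \<Phi>'"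
  shows "wf_potential \<Phi>'" "owners \<Phi>' \<subseteq> owners \<Phi>" "owners \<Phi> \<inter> (K \<union> dom \<epsilon>) \<subseteq> owners \<Phi>'"
    "\<And>Y g. Y \<in> K \<Longrightarrow> Evid Y g \<in> \<Phi> \<Longrightarrow> Evid Y g \<in> \<Phi>'"
    "\<And>\<Psi>. wf_potential \<Psi> \<Longrightarrow> owners \<Phi> \<inter> owners \<Psi> = {} \<Longrightarrow> sound (\<Phi> \<union> \<Psi>) \<Longrightarrow> sound (\<Phi>' \<union> \<Psi>)"
  using assms by (simp_all add: refines_def)

lemma refines_trans:
  assumes "refines K \<Phi> \<Phi>'" "refines K \<Phi>' \<Phi>''"
  shows "refines K \<Phi> \<Phi>''"
  unfolding refines_def
proof (intro conjI allI impI ballI)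
  note a = refinesD[OF assms(1)] and b = refinesD[OF assms(2)]
  show "wf_potential \<Phi>''" by (rule b(1))
  show "owners \<Phi>'' \<subseteq> owners \<Phi>" using a(2) b(2) by (rule subset_trans[rotated])
  show "owners \<Phi> \<inter> (K \<union> dom \<epsilon>) \<subseteq> owners \<Phi>''" using a(3) b(3) by auto
  show "Evid Y g \<in> \<Phi>''" if "Y \<in> K" "Evid Y g \<in> \<Phi>" for Y g
    using that a(4) b(4) by simp
  show "sound (\<Phi>'' \<union> \<Psi>)"
    if "wf_potential \<Psi>" "owners \<Phi> \<inter> owners \<Psi> = {}" "sound (\<Phi> \<union> \<Psi>)" for \<Psi>
  proof -
    have "owners \<Phi>' \<inter> owners \<Psi> = {}" using a(2) that(2) by auto
    then show ?thesis using a(5) b(5) that by simp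
  qed
qed

lemma refines_refl: "wf_potential \<Phi> \<Longrightarrow> refines K \<Phi> \<Phi>"
  by (simp add: refines_def)

lemma refines_mono: "refines K \<Phi> \<Phi>' \<Longrightarrow> K' \<subseteq> K \<Longrightarrow> refines K' \<Phi> \<Phi>'"
  by (auto simp: refines_def)

text \<open>This covers every operation that only deletes: initial removal of barren variables,
  their later elimination, and the discarding of absorbed evidence functions. Soundness next to
  \<open>\<Psi>\<close> comes from \<open>sound_subset\<close> applied to the union.\<close>

lemma refines_subset:
  assumes "wf_potential \<Phi>" "\<Phi>' \<subseteq> \<Phi>"
    and "\<And>\<phi>. \<phi> \<in> probs \<Phi> \<Longrightarrow> owner \<phi> \<in> K \<union> dom \<epsilon> \<Longrightarrow> \<phi> \<in> \<Phi>'"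
    and "\<And>Y g. Y \<in> K \<Longrightarrow> Evid Y g \<in> \<Phi> \<Longrightarrow> Evid Y g \<in> \<Phi>'"
  shows "refines K \<Phi> \<Phi>'"
  unfolding refines_def
proof (intro conjI allI impI)
  show "owners \<Phi> \<inter> (K \<union> dom \<epsilon>) \<subseteq> owners \<Phi>'"
    using assms(3) by (auto simp: owners_def probs_def)
  show "sound (\<Phi>' \<union> \<Psi>)"
    if "wf_potential \<Psi>" "owners \<Phi> \<inter> owners \<Psi> = {}" "sound (\<Phi> \<union> \<Psi>)" for \<Psi>
    by (rule sound_subset[OF wf_potential_Un[OF assms(1) that(1,2)] that(3)]) (use assms(2) in auto)
qed (use assms wf_potential_subset[OF assms(1,2)] owners_mono[OF assms(2)] in auto)

lemma refines_apply_evidence: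
  assumes "wf_potential \<Phi>"
  shows "refines K \<Phi> (apply_evidence \<epsilon> C ` \<Phi>)"
  unfolding refines_def
proof (intro conjI allI impI ballI)
  fix Y g assume "Evid Y g \<in> \<Phi>"
  then have "apply_evidence \<epsilon> C (Evid Y g) \<in> apply_evidence \<epsilon> C ` \<Phi>" by (rule imageI)
  then show "Evid Y g \<in> apply_evidence \<epsilon> C ` \<Phi>" by simp
qed (use assms wf_potential_apply_evidence sound_apply_evidence wf_potential_Un in auto)

text \<open>The invariant \<open>obs\<close> is carried along because an observed variable outside
  \<open>K\<close> with its head intact could be summed out by a reversal.\<close>

lemma refines_elim_step:
  assumes step: "elim_step N \<epsilon> K \<Phi> \<Phi>'" and wf: "wf_potential \<Phi>"
    and obs: "\<And>Y T g. Prob Y {Y} T g \<in> \<Phi> \<Longrightarrow> Y \<in> dom \<epsilon> \<Longrightarrow> Y \<in> K"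
  shows "refines K \<Phi> \<Phi>' \<and> (\<forall>Y T g. Prob Y {Y} T g \<in> \<Phi>' \<longrightarrow> Y \<in> dom \<epsilon> \<longrightarrow> Y \<in> K)"
  using step
proof cases
  case (arc_reversal Y T g V H T' h T'' k)
  note r = arc_reversal
  \<comment> \<open>Stated for an arbitrary set, since it is applied both to \<open>\<Phi>\<close>
    and to its union with the potentials elsewhere.\<close>
  have eq: "\<Psi> - {Prob Y {Y} T g, Prob V H T' h} \<union>
      {Prob V H T'' k, Prob Y {Y} (T'' \<union> H) (\<lambda>w. g w * h w / k w)} =
      insert (new_child Y V T g H T' h) (insert (new_parent Y T g H T' h) (rest \<Psi> Y V T g H T' h))" for \<Psi>
    unfolding r(7,8) new_child_def new_parent_def rest_def reversed_tail_def marginal_def by (simp add: insert_commute)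
  have Y: "\<epsilon> Y = None" using obs[OF r(2)] r(6) by auto
  have "sound (\<Phi>' \<union> \<Psi>)"
    if \<Psi>: "wf_potential \<Psi>" "owners \<Phi> \<inter> owners \<Psi> = {}" "sound (\<Phi> \<union> \<Psi>)" for \<Psi>
  proof -
    \<comment> \<open>Disjoint owners keep the reversed pair out of \<open>\<Psi>\<close>, so the
      reversal within \<open>\<Phi>\<close> is also a reversal within the union.\<close>
    have "Prob Y {Y} T g \<notin> \<Psi>" "Prob V H T' h \<notin> \<Psi>"
      using \<Psi>(2) r(2,3) by (force simp: owners_def probs_def)+
    then have "\<Phi>' \<union> \<Psi> = (\<Phi> \<union> \<Psi>) - {Prob Y {Y} T g, Prob V H T' h} \<union>
      {Prob V H T'' k, Prob Y {Y} (T'' \<union> H) (\<lambda>w. g w * h w / k w)}"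
      unfolding r(1) by blast
    then show ?thesis
      unfolding eq using sound_reversal[OF wf_potential_Un[OF wf \<Psi>(1,2)] _ _ r(4) \<Psi>(3) Y] r(2,3)
      by simp
  qed
  moreover have "wf_potential \<Phi>'"
    unfolding r(1) eq using wf_reversal[OF wf r(2-4)] .
  moreover have "owners \<Phi>' = owners \<Phi>"
  proof -
    have "owners \<Phi>' = insert Y (insert V (owners (\<Phi> - {Prob Y {Y} T g, Prob V H T' h})))"
      unfolding r(1) by auto
    also have "\<dots> = owners (insert (Prob Y {Y} T g) (insert (Prob V H T' h)
        (\<Phi> - {Prob Y {Y} T g, Prob V H T' h})))"
      by simp
    also have "insert (Prob Y {Y} T g) (insert (Prob V H T' h)
        (\<Phi> - {Prob Y {Y} T g, Prob V H T' h})) = \<Phi>"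
      using r(2,3) by blast
    finally show ?thesis .
  qed
  moreover have "\<forall>Y T g. Prob Y {Y} T g \<in> \<Phi>' \<longrightarrow> Y \<in> dom \<epsilon> \<longrightarrow> Y \<in> K"
    using obs r(1-3) by blast
  ultimately show ?thesis
    using r(1) by (auto simp: refines_def)
next
  case (barren_elimination Y)
  have "refines K \<Phi> \<Phi>'"
    by (rule refines_subset[OF wf]) (use barren_elimination in \<open>auto simp: probs_def\<close>)
  then show ?thesis using obs barren_elimination(1) by blast
next
  case (absorbed Y)
  have "refines K \<Phi> \<Phi>'"
    by (rule refines_subset[OF wf]) (use absorbed in \<open>auto simp: probs_def\<close>)
  then show ?thesis using obs absorbed(1) by blast
qed

lemma refines_elim_steps:
  assumes "(elim_step N \<epsilon> K)\<^sup>*\<^sup>* \<Phi> \<Phi>'" and "wf_potential \<Phi>"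
    and "\<And>Y T g. Prob Y {Y} T g \<in> \<Phi> \<Longrightarrow> Y \<in> dom \<epsilon> \<Longrightarrow> Y \<in> K"
  shows "refines K \<Phi> \<Phi>' \<and> (\<forall>Y T g. Prob Y {Y} T g \<in> \<Phi>' \<longrightarrow> Y \<in> dom \<epsilon> \<longrightarrow> Y \<in> K)"
  using assms(1)
proof induction
  case base
  then show ?case using assms(2,3) refines_refl by blast
next
  case (step \<Phi>' \<Phi>'')
  then have "wf_potential \<Phi>'" by (simp add: refines_def)
  then have "refines K \<Phi>' \<Phi>'' \<and> (\<forall>Y T g. Prob Y {Y} T g \<in> \<Phi>'' \<longrightarrow> Y \<in> dom \<epsilon> \<longrightarrow> Y \<in> K)"
    by (rule refines_elim_step[OF step.hyps(2)]) (use step.IH in blast)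
  then show ?case
    using refines_trans[OF conjunct1[OF step.IH]] by simp
qed

lemma refines_remove_barren:
  assumes "wf_potential \<Phi>"
  shows "refines K \<Phi> (remove_barren \<epsilon> K \<Phi>)"
proof -
  have "Y \<notin> K \<and> \<epsilon> Y = None" if "Y \<in> barren \<epsilon> K \<Phi>" for Y
    using that by (auto simp: barren_def)
  then show ?thesis
    by (intro refines_subset[OF assms]) (fastforce simp: remove_barren_def probs_def)+
qed

lemma refines_projection:
  assumes wf: "wf_potential \<Phi>" and dom: "\<And>\<phi>. \<phi> \<in> \<Phi> \<Longrightarrow> domain \<phi> \<subseteq> C \<union> R"
    and proj: "projection N \<epsilon> C D R \<Phi> \<Phi>'"
  shows "refines (C \<inter> D \<union> R) \<Phi> \<Phi>'"
proof -
  let ?K = "C \<inter> D \<union> R"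
  let ?\<Phi>1 = "remove_barren \<epsilon> (D \<union> R) \<Phi>"
  let ?\<Phi>2 = "apply_evidence \<epsilon> C ` ?\<Phi>1"
  have 1: "refines ?K \<Phi> ?\<Phi>1"
    by (rule refines_mono[OF refines_remove_barren[OF wf]]) auto
  then have 2: "refines ?K ?\<Phi>1 ?\<Phi>2"
    by (intro refines_apply_evidence) (simp add: refines_def)
  \<comment> \<open>An observed variable of \<open>C\<close> has lost its head, so no observed variable is ever summed out.\<close>
  have "Y \<in> ?K" if P: "Prob Y {Y} T g \<in> ?\<Phi>2" and Y: "Y \<in> dom \<epsilon>" for Y T g
  proof -
    obtain \<phi> where \<phi>: "\<phi> \<in> \<Phi>" "Prob Y {Y} T g = apply_evidence \<epsilon> C \<phi>"
      using P by (auto simp: remove_barren_def)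
    obtain H T' g' where "\<phi> = Prob Y H T' g'" "{Y} = H - C \<inter> dom \<epsilon>"
      using \<phi>(2) by (cases \<phi>) auto
    \<comment> \<open>\<open>Y\<close> lies in the domain of \<open>\<phi>\<close>, hence in
      \<open>C\<close> or \<open>R\<close>; in \<open>C\<close> it would have been instantiated and
      lost its head.\<close>
    then show ?thesis using Y dom[OF \<phi>(1)] by auto
  qed
  then have "refines ?K ?\<Phi>2 \<Phi>'"
    using refines_elim_steps[of ?K ?\<Phi>2 \<Phi>'] proj 2 by (simp add: projection_def refines_def)
  then show ?thesis by (rule refines_trans[OF refines_trans[OF 1 2]])
qed

end

section \<open>Branches of a junction tree\<close>

locale junction = evidence_network N \<epsilon> for N :: "('v, 's) bayes_net" and \<epsilon> +
  fixes J :: "'v jtree"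
  assumes jt: "junction_tree N J"
begin

lemma tree: "is_tree J" using jt by (simp add: junction_tree_def)

lemma links_cliques: "(C, D) \<in> links J \<Longrightarrow> C \<in> cliques J \<and> D \<in> cliques J"
  and links_sym: "(C, D) \<in> links J \<Longrightarrow> (D, C) \<in> links J"
  and links_irrefl: "(C, D) \<in> links J \<Longrightarrow> C \<noteq> D"
  using tree by (auto simp: is_tree_def sym_def irrefl_def)

lemma path_cliques:
  assumes "clique_path J C p D"
  shows "C \<in> cliques J" "D \<in> cliques J"
  using assms hd_in_set last_in_set unfolding clique_path_def by blast+

lemma path_unique: "clique_path J C p D \<Longrightarrow> clique_path J C q D \<Longrightarrow> p = q"
  using tree path_cliques[of C p D] unfolding is_tree_def by blast

lemma path_exists: "C \<in> cliques J \<Longrightarrow> D \<in> cliques J \<Longrightarrow> \<exists>p. clique_path J C p D"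
  using tree unfolding is_tree_def by blast

lemma path_rev:
  assumes "clique_path J C p D"
  shows "clique_path J D (rev p) C"
proof -
  have "successively (\<lambda>E F. (F, E) \<in> links J) p"
    using assms links_sym by (auto simp: clique_path_def elim: successively_mono)
  then show ?thesis
    using assms by (auto simp: clique_path_def hd_rev last_rev successively_rev)
qed

lemma path_prefix:
  assumes "clique_path J C (xs @ F # ys) D"
  shows "clique_path J C (xs @ [F]) F"
proof -
  have "successively (\<lambda>E F. (E, F) \<in> links J) ((xs @ [F]) @ ys)"
    using assms by (simp add: clique_path_def)
  then have "successively (\<lambda>E F. (E, F) \<in> links J) (xs @ [F])"
    unfolding successively_append_iff by blast
  moreover have "hd (xs @ [F]) = C" using assms by (cases xs) (auto simp: clique_path_def)
  ultimately show ?thesis using assms unfolding clique_path_def by simp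
qed

lemma path_Cons:
  assumes "(C, D) \<in> links J" "clique_path J D p F" "C \<notin> set p"
  shows "clique_path J C (C # p) F"
  using assms links_cliques by (cases p) (auto simp: clique_path_def)

lemma path_tl: "clique_path J C (C # D # p) F \<Longrightarrow> (C, D) \<in> links J \<and> clique_path J D (D # p) F"
  by (auto simp: clique_path_def)

text \<open>The cliques that a message from \<open>E\<close> to \<open>C\<close> summarizes.\<close>

definition branch :: "'v set \<Rightarrow> 'v set \<Rightarrow> 'v set set" where
  "branch C E = {F. \<exists>q. clique_path J C (C # E # q) F}"

text \<open>The unique path from \<open>C\<close> to a clique determines its second member.\<close>

lemma branch_disjoint: "E \<noteq> E' \<Longrightarrow> branch C E \<inter> branch C E' = {}"
  unfolding branch_def using path_unique by blast

lemma self_notin_branch: "C \<notin> branch C E"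
proof
  assume "C \<in> branch C E"
  then obtain q where q: "clique_path J C (C # E # q) C" by (auto simp: branch_def)
  moreover have "clique_path J C [C] C" using path_cliques[OF q] by (simp add: clique_path_def)
  ultimately show False using path_unique by blast
qed

lemma branch_cover:
  assumes "C \<in> cliques J" "F \<in> cliques J" "F \<noteq> C"
  obtains E where "E \<in> adj J C" "F \<in> branch C E"
proof -
  obtain p where p: "clique_path J C p F" using path_exists assms by blast
  then obtain E q where "p = C # E # q"
    using assms(3) by (cases p; cases "tl p") (auto simp: clique_path_def)
  then show ?thesis using that p by (auto simp: branch_def adj_def clique_path_def)
qed

text \<open>The recursion behind message passing: the right-hand side lists the sources of the
  potentials from which the message from \<open>C\<close> to \<open>D\<close> is computed.\<close>

lemma branch_link:
  assumes "(C, D) \<in> links J"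
  shows "branch D C = insert C (\<Union>E\<in>adj J C - {D}. branch C E)"
proof (intro equalityI subsetI)
  fix F assume "F \<in> branch D C"
  then obtain q where q: "clique_path J D (D # C # q) F" by (auto simp: branch_def)
  show "F \<in> insert C (\<Union>E\<in>adj J C - {D}. branch C E)"
  proof (cases q)
    case Nil
    then show ?thesis using q by (auto simp: clique_path_def)
  next
    case (Cons E r)
    then have "F \<in> branch C E" "E \<in> adj J C" "E \<noteq> D"
      using q path_tl[OF q] by (auto simp: branch_def adj_def clique_path_def)
    then show ?thesis by blast
  qed
next
  fix F assume F: "F \<in> insert C (\<Union>E\<in>adj J C - {D}. branch C E)"
  have CD: "clique_path J C [C, D] D"
    using assms links_cliques links_irrefl by (auto simp: clique_path_def)
  show "F \<in> branch D C"
  proof (cases "F = C")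
    case True
    have "clique_path J D (D # C # []) C" using path_rev[OF CD] by simp
    then show ?thesis using True unfolding branch_def by blast
  next
    case False
    then obtain E q where E: "E \<noteq> D" and q: "clique_path J C (C # E # q) F"
      using F by (auto simp: branch_def)
    \<comment> \<open>Otherwise the initial segment up to \<open>D\<close> would be a second path
      from \<open>C\<close> to its neighbour \<open>D\<close>.\<close>
    have "D \<notin> set (C # E # q)"
    proof
      assume "D \<in> set (C # E # q)"
      then have "D \<in> set q" using E links_irrefl[OF assms] by auto
      then obtain xs ys where "q = xs @ D # ys" using split_list by fast
      then have "clique_path J C ((C # E # xs) @ [D]) D"
        using q path_prefix[of C "C # E # xs" D ys F] by simp
      then have "(C # E # xs) @ [D] = [C, D]" using CD path_unique by blast
      then show False by simp
    qed
    then have "clique_path J D (D # C # E # q) F"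
      using path_Cons[OF links_sym[OF assms] q] by simp
    then show ?thesis by (auto simp: branch_def)
  qed
qed

lemma path_in_branch:
  assumes "clique_path J C (C # E # q) F" "G \<in> set (E # q)"
  shows "G \<in> branch C E"
proof -
  obtain xs ys where eq: "E # q = xs @ G # ys" using split_list[OF assms(2)] by fast
  then have "clique_path J C ((C # xs) @ [G]) G"
    using assms(1) path_prefix[of C "C # xs" G ys F] by simp
  moreover obtain r where "(C # xs) @ [G] = C # E # r" using eq by (cases xs) auto
  ultimately show ?thesis unfolding branch_def by auto
qed

section \<open>The running intersection property across branches\<close>

lemma running_intersection:
  assumes "clique_path J C p D" "E \<in> set p" "Y \<in> C" "Y \<in> D"
  shows "Y \<in> E"
proof -
  have "\<forall>C D p E. clique_path J C p D \<and> E \<in> set p \<longrightarrow> C \<inter> D \<subseteq> E"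
    using jt by (simp add: junction_tree_def)
  from this[rule_format, OF conjI[OF assms(1,2)]] show ?thesis using assms(3,4) by blast
qed

lemma separator_branch:
  assumes "F \<in> branch D C" "Y \<in> F" "Y \<in> D"
  shows "Y \<in> C"
proof -
  obtain q where q: "clique_path J D (D # C # q) F" using assms(1) by (auto simp: branch_def)
  show ?thesis by (rule running_intersection[OF q]) (use assms in auto)
qed

text \<open>Reversing the path from \<open>C\<close> to \<open>B\<close> and appending the path from
  \<open>C\<close> to \<open>F\<close> gives a path through \<open>C\<close>; it has no repetitions
  because the branches are disjoint.\<close>

lemma separator_branches:
  assumes "B \<in> branch C E" "F \<in> branch C E'" "E \<noteq> E'" "Y \<in> B" "Y \<in> F"
  shows "Y \<in> C"
proof -
  obtain q where q: "clique_path J C (C # E # q) B" using assms(1) by (auto simp: branch_def)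
  obtain q' where q': "clique_path J C (C # E' # q') F" using assms(2) by (auto simp: branch_def)
  have "set (E # q) \<inter> set (E' # q') = {}"
    using path_in_branch[OF q] path_in_branch[OF q'] branch_disjoint[OF assms(3)] by blast
  then have "clique_path J B (rev (E # q) @ C # E' # q') F"
    using path_rev[OF q] q'
    by (auto simp: clique_path_def successively_append_iff hd_append)
  then show ?thesis
    by (rule running_intersection) (use assms in auto)
qed

end

section \<open>Messages\<close>

context junction
begin

text \<open>These variables index the CPDs held by a part of the tree. As each variable has one
  home, disjoint parts have disjoint owners.\<close>

definition homed :: "'v set set \<Rightarrow> 'v set" where
  "homed \<F> = {Y \<in> variables N. home J Y \<in> \<F>}"

lemma homed_Un: "homed (\<F> \<union> \<F>') = homed \<F> \<union> homed \<F>'"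
  and homed_Union: "homed (\<Union>\<A>) = (\<Union>\<F>\<in>\<A>. homed \<F>)"
  by (auto simp: homed_def)

lemma disjoint_mono: "U \<subseteq> U' \<Longrightarrow> U' \<inter> W = {} \<Longrightarrow> U \<inter> W = {}"
  for U U' W :: "'x set"
  by auto

lemma homed_subset: "homed \<F> \<subseteq> variables N"
  by (auto simp: homed_def)

lemma homed_disjoint: "\<F> \<inter> \<F>' = {} \<Longrightarrow> homed \<F> \<inter> homed \<F>' = {}"
  by (auto simp: homed_def)

lemma homed_mem: "Y \<in> variables N \<Longrightarrow> Y \<in> home J Y"
  and home_clique: "Y \<in> variables N \<Longrightarrow> home J Y \<in> cliques J"
  and family_home: "Y \<in> variables N \<Longrightarrow> family N Y \<subseteq> home J Y"
  using jt by (auto simp: junction_tree_def family_def)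

lemma clique_subset: "C \<in> cliques J \<Longrightarrow> C \<subseteq> variables N"
  using jt by (auto simp: junction_tree_def)

lemma finite_adj: "finite (adj J C)"
proof (rule finite_subset)
  show "adj J C \<subseteq> Pow (variables N)"
    using links_cliques clique_subset by (fastforce simp: adj_def)
qed (simp add: fin_vars)

lemma cpd_potential_eq: "cpd_potential N J C = cpds N (homed {C})"
  by (auto simp: cpd_potential_def cpds_def homed_def)

text \<open>\<open>R\<close> is the set of additional variables that are not eliminated, as in \<^const>\<open>message\<close>.\<close>

definition summarizes :: "'v set \<Rightarrow> 'v set \<Rightarrow> 'v set \<Rightarrow> ('v, 's) potential \<Rightarrow> bool" where
  "summarizes R C D m \<longleftrightarrow>
     wf_potential m \<and> (\<forall>\<phi>\<in>m. domain \<phi> \<subseteq> C \<inter> D \<union> R) \<and>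
     owners m \<subseteq> homed (branch D C) \<and> homed (branch D C) \<inter> (D \<union> R \<union> dom \<epsilon>) \<subseteq> owners m \<and>
     (\<forall>Y\<in>R. Evid Y (evidence_function N \<epsilon> Y) \<in> m) \<and>
     (\<forall>\<Psi>. wf_potential \<Psi> \<longrightarrow> homed (branch D C) \<inter> owners \<Psi> = {} \<longrightarrow>
        sound (cpds N (homed (branch D C)) \<union> \<Psi>) \<longrightarrow> sound (m \<union> \<Psi>))"

lemma summarizesD:
  assumes "summarizes R C D m"
  shows "wf_potential m" "\<And>\<phi>. \<phi> \<in> m \<Longrightarrow> domain \<phi> \<subseteq> C \<inter> D \<union> R"
    "owners m \<subseteq> homed (branch D C)" "homed (branch D C) \<inter> (D \<union> R \<union> dom \<epsilon>) \<subseteq> owners m"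
    "\<And>Y. Y \<in> R \<Longrightarrow> Evid Y (evidence_function N \<epsilon> Y) \<in> m"
    "\<And>\<Psi>. wf_potential \<Psi> \<Longrightarrow> homed (branch D C) \<inter> owners \<Psi> = {} \<Longrightarrow>
        sound (cpds N (homed (branch D C)) \<union> \<Psi>) \<Longrightarrow> sound (m \<union> \<Psi>)"
  using assms by (simp_all add: summarizes_def)

text \<open>\<open>R\<close> may vary with the neighbour, since after variable propagation only the
  message along the path retains additional variables. Owners of different messages are disjoint
  because the branches are.\<close>

lemma wf_messages:
  assumes "finite \<E>" "\<And>E. E \<in> \<E> \<Longrightarrow> summarizes (R E) E C (m E)"
  shows "wf_potential (\<Union>E\<in>\<E>. m E)" "owners (\<Union>E\<in>\<E>. m E) \<subseteq> homed (\<Union>E\<in>\<E>. branch C E)"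
proof -
  show own: "owners (\<Union>E\<in>\<E>. m E) \<subseteq> homed (\<Union>E\<in>\<E>. branch C E)"
    using summarizesD(3)[OF assms(2)] by (auto simp: homed_Union)
  show "wf_potential (\<Union>E\<in>\<E>. m E)"
    using assms
  proof (induction \<E>)
    case empty
    show ?case by (simp add: wf_potential_def)
  next
    case (insert E \<E>)
    have "owners (m E) \<inter> owners (\<Union>E\<in>\<E>. m E) = {}"
    proof (rule equals0I)
      fix Y assume "Y \<in> owners (m E) \<inter> owners (\<Union>E\<in>\<E>. m E)"
      then obtain E' where "E' \<in> \<E>" "Y \<in> homed (branch C E)" "Y \<in> homed (branch C E')"
        using summarizesD(3)[OF insert.prems] by auto
      then show False
        using homed_disjoint[OF branch_disjoint[of E E' C]] insert.hyps(2) by blast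
    qed
    then show ?case
      using wf_potential_Un[of "m E" "\<Union>E\<in>\<E>. m E"] insert summarizesD(1)[OF insert.prems]
      by simp
  qed
qed

text \<open>The branches are replaced by their messages one at a time. While one is replaced, the
  CPDs of the other branches belong to the surroundings; afterwards its message does. Hence
  \<open>\<Psi>\<close> is arbitrary in the induction.\<close>

lemma sound_messages:
  assumes "finite \<E>" "\<And>E. E \<in> \<E> \<Longrightarrow> summarizes (R E) E C (m E)"
    and "wf_potential \<Psi>" "homed (\<Union>E\<in>\<E>. branch C E) \<inter> owners \<Psi> = {}"
    and "sound (cpds N (homed (\<Union>E\<in>\<E>. branch C E)) \<union> \<Psi>)"
  shows "sound ((\<Union>E\<in>\<E>. m E) \<union> \<Psi>)"
  using assms
proof (induction \<E> arbitrary: \<Psi>)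
  case empty
  then show ?case by (simp add: cpds_def homed_def)
next
  case (insert E \<E>)
  let ?W = "homed (\<Union>E\<in>\<E>. branch C E)"
  note mE = summarizesD[OF insert.prems(1)[OF insertI1]]
  have "branch C E \<inter> branch C E' = {}" if "E' \<in> \<E>" for E'
    by (rule branch_disjoint) (use insert.hyps(2) that in auto)
  then have dis: "homed (branch C E) \<inter> ?W = {}"
    by (intro homed_disjoint) (simp add: Int_UN_distrib)
  have W: "homed (\<Union>E\<in>insert E \<E>. branch C E) = homed (branch C E) \<union> ?W"
    by (simp add: homed_Un)
  have d\<Psi>: "homed (branch C E) \<inter> owners \<Psi> = {}" "?W \<inter> owners \<Psi> = {}"
    using insert.prems(3) unfolding W by (simp_all add: Int_Un_distrib2)
  have dm: "?W \<inter> owners (m E) = {}"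
    using disjoint_mono[OF mE(3) dis] by (simp add: Int_commute)
  have wf1: "wf_potential (cpds N ?W \<union> \<Psi>)"
    by (rule wf_potential_Un[OF wf_cpds[OF homed_subset] insert.prems(2)]) (simp add: d\<Psi>)
  have wf2: "wf_potential (m E \<union> \<Psi>)"
    by (rule wf_potential_Un[OF mE(1) insert.prems(2) disjoint_mono[OF mE(3) d\<Psi>(1)]])
  have "sound (m E \<union> (cpds N ?W \<union> \<Psi>))"
  proof (rule mE(6)[OF wf1])
    show "homed (branch C E) \<inter> owners (cpds N ?W \<union> \<Psi>) = {}"
      by (simp add: Int_Un_distrib dis d\<Psi>)
    show "sound (cpds N (homed (branch C E)) \<union> (cpds N ?W \<union> \<Psi>))"
      using insert.prems(4) unfolding W cpds_Un Un_assoc .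
  qed
  then have "sound (cpds N ?W \<union> (m E \<union> \<Psi>))"
    by (simp add: Un_left_commute)
  moreover have "?W \<inter> owners (m E \<union> \<Psi>) = {}"
    by (simp add: Int_Un_distrib dm d\<Psi>)
  ultimately have "sound ((\<Union>E\<in>\<E>. m E) \<union> (m E \<union> \<Psi>))"
    using insert.IH[OF _ wf2] insert.prems(1) by simp
  then show ?case by (simp add: Un_left_commute Un_assoc)
qed

section \<open>The combined potential of a clique and some of its neighbours\<close>

context
  fixes C :: "'v set" and \<E> :: "'v set set" and R :: "'v set \<Rightarrow> 'v set" and M :: "('v, 's) messages"
  assumes \<E>: "\<E> \<subseteq> adj J C" and C: "C \<in> cliques J"
    and msgs: "\<And>E. E \<in> \<E> \<Longrightarrow> summarizes (R E) E C (the (M (E, C)))"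
begin

abbreviation "clique_factors \<equiv> combined N J \<epsilon> M C \<E>"

abbreviation "side \<equiv> insert C (\<Union>E\<in>\<E>. branch C E)"

lemma finite_branches: "finite \<E>"
  using \<E> finite_adj finite_subset by blast

lemma homed_side: "homed side = homed {C} \<union> homed (\<Union>E\<in>\<E>. branch C E)"
  by (auto simp: homed_def)

lemma owners_messages: "owners (\<Union>E\<in>\<E>. the (M (E, C))) \<subseteq> homed (\<Union>E\<in>\<E>. branch C E)"
  by (rule wf_messages(2)[OF finite_branches msgs])

lemma probs_evidence: "probs (evidence_potential N \<epsilon> C) = {}"
  by (auto simp: probs_def evidence_potential_def)

lemma wf_evidence: "wf_potential (evidence_potential N \<epsilon> C)"
proof -
  have "evidence_potential N \<epsilon> C = (\<lambda>Y. Evid Y (evidence_function N \<epsilon> Y)) ` C"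
    by (auto simp: evidence_potential_def)
  then have "finite (evidence_potential N \<epsilon> C)"
    using finite_subset[OF clique_subset[OF C] fin_vars] by simp
  then show ?thesis
    unfolding wf_potential_def probs_evidence by (auto simp: evidence_potential_def)
qed

lemma side_disjoint: "homed {C} \<inter> homed (\<Union>E\<in>\<E>. branch C E) = {}"
  by (rule homed_disjoint) (use self_notin_branch in auto)

lemma wf_local: "wf_potential (cpds N (homed {C}) \<union> evidence_potential N \<epsilon> C)"
  by (rule wf_potential_Un[OF wf_cpds[OF homed_subset] wf_evidence])
    (simp add: owners_def probs_evidence)

lemma owners_local: "owners (cpds N (homed {C}) \<union> evidence_potential N \<epsilon> C) = homed {C}"
  by (simp add: owners_def[of "evidence_potential N \<epsilon> C"] probs_evidence)

lemma combined_eq: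
  "clique_factors = (cpds N (homed {C}) \<union> evidence_potential N \<epsilon> C) \<union> (\<Union>E\<in>\<E>. the (M (E, C)))"
  by (simp add: combined_def cpd_potential_eq)

lemma wf_combined: "wf_potential clique_factors"
  unfolding combined_eq
proof (rule wf_potential_Un[OF wf_local wf_messages(1)[OF finite_branches msgs]])
  have "homed {C} \<inter> owners (\<Union>E\<in>\<E>. the (M (E, C))) \<subseteq> {}"
    using Int_mono[OF subset_refl[of "homed {C}"] owners_messages] by (simp only: side_disjoint)
  then show "owners (cpds N (homed {C}) \<union> evidence_potential N \<epsilon> C) \<inter>
      owners (\<Union>E\<in>\<E>. the (M (E, C))) = {}"
    unfolding owners_local by (rule subset_empty[THEN iffD1])
qed

lemma owners_combined: "owners clique_factors \<subseteq> homed side"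
  unfolding combined_eq owners_simps(3)[of "_ \<union> _" "\<Union>_"] owners_local homed_side
  by (rule Un_mono[OF subset_refl owners_messages])

lemma owners_combined_home: "homed {C} \<subseteq> owners clique_factors"
  by (auto simp: combined_def cpd_potential_eq)

lemma owners_combined_branch:
  "E \<in> \<E> \<Longrightarrow> homed (branch C E) \<inter> (C \<union> R E \<union> dom \<epsilon>) \<subseteq> owners clique_factors"
  using summarizesD(4)[OF msgs] by (auto simp: combined_def)

text \<open>Messages into \<open>C\<close> never lose the potential of a variable of
  \<open>C\<close> or of an observed variable.\<close>

lemma owners_combined_kept:
  assumes "Y \<in> homed side" "Y \<in> C \<or> Y \<in> dom \<epsilon>"
  shows "Y \<in> owners clique_factors"
proof (cases "Y \<in> homed {C}")
  case False
  then obtain E where "E \<in> \<E>" "Y \<in> homed (branch C E)"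
    using assms(1) by (auto simp: homed_def)
  then show ?thesis
    using owners_combined_branch[of E] assms(2) by blast
qed (use owners_combined_home in blast)

text \<open>The CPDs and evidence functions at \<open>C\<close> itself join the surroundings while
  the messages replace the branches.\<close>

lemma sound_combined:
  assumes "wf_potential \<Psi>" "homed side \<inter> owners \<Psi> = {}" "sound (cpds N (homed side) \<union> \<Psi>)"
  shows "sound (clique_factors \<union> \<Psi>)"
proof -
  let ?W = "homed (\<Union>E\<in>\<E>. branch C E)" and ?L = "cpds N (homed {C}) \<union> evidence_potential N \<epsilon> C"
  have d: "homed {C} \<inter> owners \<Psi> = {}" "?W \<inter> owners \<Psi> = {}"
    using assms(2) unfolding homed_side by (simp_all add: Int_Un_distrib2)
  have "sound ((\<Union>E\<in>\<E>. the (M (E, C))) \<union> (?L \<union> \<Psi>))"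
  proof (rule sound_messages[OF finite_branches msgs])
    show "wf_potential (?L \<union> \<Psi>)"
      by (rule wf_potential_Un[OF wf_local assms(1)]) (use d owners_local in simp)
    show "?W \<inter> owners (?L \<union> \<Psi>) = {}"
    proof -
      have "owners (?L \<union> \<Psi>) = homed {C} \<union> owners \<Psi>"
        by (simp only: owners_local owners_simps(3)[of ?L])
      then show ?thesis using d side_disjoint by blast
    qed
    \<comment> \<open>Evidence functions are not probability potentials, so adding them does not
      affect soundness.\<close>
    show "sound (cpds N ?W \<union> (?L \<union> \<Psi>))"
      by (rule sound_probs_cong[OF _ assms(3)])
        (simp only: homed_side cpds_Un probs_evidence probs_simps probs_cpds, blast)
  qed
  then show ?thesis
    by (simp add: combined_def cpd_potential_eq Un_ac)
qed

lemma domain_combined: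
  assumes "\<phi> \<in> clique_factors"
  shows "domain \<phi> \<subseteq> C \<union> (\<Union>E\<in>\<E>. R E)"
proof -
  consider "\<phi> \<in> cpd_potential N J C" | "\<phi> \<in> evidence_potential N \<epsilon> C"
    | E where "E \<in> \<E>" "\<phi> \<in> the (M (E, C))"
    using assms by (auto simp: combined_def)
  then show ?thesis
  proof cases
    case 1
    then show ?thesis using family_home by (fastforce simp: cpd_potential_def family_def)
  next
    case 2
    then show ?thesis by (auto simp: evidence_potential_def)
  next
    case 3
    then show ?thesis using summarizesD(2)[OF msgs[OF 3(1)] 3(2)] by blast
  qed
qed

lemma evid_combined:
  assumes "Y \<in> C \<union> (\<Union>E\<in>\<E>. R E)"
  shows "Evid Y (evidence_function N \<epsilon> Y) \<in> clique_factors"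
  using assms summarizesD(5)[OF msgs] by (auto simp: combined_def evidence_potential_def)

end

text \<open>Incoming messages summarize their branches, and projection preserves soundness next to
  any surroundings. The last premise says where a retained variable comes from: from
  \<open>C\<close>, or with a message from the branch of its home, whose owners then include
  it.\<close>

lemma message_summarizes:
  assumes CD: "(C, D) \<in> links J" and msg: "message N J \<epsilon> R M C D m"
    and msgs: "\<And>E. E \<in> adj J C - {D} \<Longrightarrow> summarizes (R' E) E C (the (M (E, C)))"
    and R': "\<And>E. E \<in> adj J C - {D} \<Longrightarrow> R' E \<subseteq> R"
    and R: "\<And>Y. Y \<in> R \<Longrightarrow> Y \<in> C \<or> (\<exists>E\<in>adj J C - {D}. Y \<in> R' E \<and> home J Y \<in> branch C E)"
  shows "summarizes R C D m"
proof -
  let ?\<E> = "adj J C - {D}"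
  let ?\<Phi> = "combined N J \<epsilon> M C ?\<E>"
  have sub: "?\<E> \<subseteq> adj J C" and C: "C \<in> cliques J" using links_cliques[OF CD] by auto
  note comb = wf_combined[where R = R', OF sub C msgs] owners_combined[where R = R', OF sub C msgs]
    owners_combined_kept[where R = R', OF sub C msgs] sound_combined[where R = R', OF sub C msgs]
    domain_combined[where R = R', OF sub C msgs] evid_combined[where R = R', OF sub C msgs]
    owners_combined_branch[where R = R', OF sub C msgs]
  note side = branch_link[OF CD]
  have own: "owners ?\<Phi> \<subseteq> homed (branch D C)"
    unfolding side by (rule comb(2))
  have proj: "projection N \<epsilon> C D R ?\<Phi> m" using msg by (simp add: message_def)
  have ref: "refines (C \<inter> D \<union> R) ?\<Phi> m"
  proof (rule refines_projection[OF comb(1) _ proj])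
    show "domain \<phi> \<subseteq> C \<union> R" if "\<phi> \<in> ?\<Phi>" for \<phi>
      using comb(5)[OF _ that] R' by blast
  qed
  note ref = refinesD[OF ref]
  show ?thesis
    unfolding summarizes_def
  proof (intro conjI ballI allI impI)
    show "wf_potential m" by (rule ref(1))
    show "domain \<phi> \<subseteq> C \<inter> D \<union> R" if "\<phi> \<in> m" for \<phi>
      using proj that by (simp add: projection_def)
    show "owners m \<subseteq> homed (branch D C)"
      by (rule subset_trans[OF ref(2) own])
    show "homed (branch D C) \<inter> (D \<union> R \<union> dom \<epsilon>) \<subseteq> owners m"
    proof
      fix Y assume Y: "Y \<in> homed (branch D C) \<inter> (D \<union> R \<union> dom \<epsilon>)"
      then have YN: "Y \<in> variables N" and hY: "home J Y \<in> branch D C" by (auto simp: homed_def)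
      \<comment> \<open>By running intersection, so that \<open>Y\<close> belongs to the separator
        and is kept by the projection.\<close>
      have YC: "Y \<in> C" if "Y \<in> D"
        using separator_branch[OF hY homed_mem[OF YN] that] .
      have "Y \<in> owners ?\<Phi>"
      proof (cases "Y \<in> C \<or> Y \<in> dom \<epsilon>")
        case True
        then show ?thesis by (intro comb(3)) (use Y in \<open>auto simp: side\<close>)
      next
        case False
        then have "Y \<in> R" using Y YC by auto
        then obtain E where "E \<in> ?\<E>" "Y \<in> R' E" "Y \<in> homed (branch C E)"
          using R[of Y] False YN by (auto simp: homed_def)
        then show ?thesis by (intro subsetD[OF comb(7)[of E]]) simp_all
      qed
      then show "Y \<in> owners m" by (intro subsetD[OF ref(3)]) (use Y YC in auto)
    qed
    show "Evid Y (evidence_function N \<epsilon> Y) \<in> m" if "Y \<in> R" for Y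
      by (rule ref(4)) (use that R[OF that] comb(6)[of Y] in auto)
    show "sound (m \<union> \<Psi>)"
      if \<Psi>: "wf_potential \<Psi>" "homed (branch D C) \<inter> owners \<Psi> = {}"
        "sound (cpds N (homed (branch D C)) \<union> \<Psi>)" for \<Psi>
    proof (rule ref(5)[OF \<Psi>(1)])
      show "owners ?\<Phi> \<inter> owners \<Psi> = {}" by (rule disjoint_mono[OF own \<Psi>(2)])
      show "sound (?\<Phi> \<union> \<Psi>)"
        by (rule comb(4)) (use \<Psi> in \<open>simp_all only: side\<close>)
    qed
  qed
qed

section \<open>Two-phase message passing\<close>

lemma send_messages_summarize:
  assumes "send_messages N J \<epsilon> L M M'" and "L \<subseteq> links J"
    and "\<And>C D. (C, D) \<in> dom M \<Longrightarrow> summarizes {} C D (the (M (C, D)))"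
  shows "dom M \<subseteq> dom M' \<and> (\<forall>C D. (C, D) \<in> dom M' \<longrightarrow> summarizes {} C D (the (M' (C, D))))"
  using assms(1)
proof induction
  case start
  then show ?case using assms(3) by simp
next
  case (send M' C D \<Phi>)
  have "summarizes {} C D \<Phi>"
  proof (rule message_summarizes[where R' = "\<lambda>_. {}"])
    show "(C, D) \<in> links J" using send.hyps(2) assms(2) by auto
    show "message N J \<epsilon> {} M' C D \<Phi>" by (rule send.hyps(5))
    show "summarizes {} E C (the (M' (E, C)))" if "E \<in> adj J C - {D}" for E
      using send.IH send.hyps(4) that by blast
  qed auto
  moreover have d: "dom (M'((C, D) \<mapsto> \<Phi>)) = insert (C, D) (dom M')"
    by simp
  ultimately show ?case
  proof (intro conjI allI impI)
    show "dom M \<subseteq> dom (M'((C, D) \<mapsto> \<Phi>))"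
      unfolding d by (rule subset_insertI2[OF conjunct1[OF send.IH]])
    fix E F assume EF: "(E, F) \<in> dom (M'((C, D) \<mapsto> \<Phi>))"
    show "summarizes {} E F (the ((M'((C, D) \<mapsto> \<Phi>)) (E, F)))"
    proof (cases "(E, F) = (C, D)")
      case True
      then show ?thesis using \<open>summarizes {} C D \<Phi>\<close> by simp
    next
      case False
      then have "(E, F) \<in> dom M'" using EF unfolding d by (elim insertE) simp_all
      then show ?thesis
        using conjunct2[OF send.IH] unfolding fun_upd_other[OF False] by simp
    qed
  qed
qed

lemma fully_propagated_summarizes:
  assumes "fully_propagated N J \<epsilon> M" "(C, D) \<in> links J"
  shows "summarizes {} C D (the (M (C, D)))"
proof -
  obtain Z M0 where Z: "Z \<in> cliques J"
    and 0: "send_messages N J \<epsilon> (towards J Z) Map.empty M0" "towards J Z \<subseteq> dom M0"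
    and 1: "send_messages N J \<epsilon> ((towards J Z)\<inverse>) M0 M" "(towards J Z)\<inverse> \<subseteq> dom M"
    using assms(1) by (auto simp: fully_propagated_def)
  have sub: "towards J Z \<subseteq> links J" "(towards J Z)\<inverse> \<subseteq> links J"
    using links_sym by (auto simp: towards_def)
  have s0: "\<forall>C D. (C, D) \<in> dom M0 \<longrightarrow> summarizes {} C D (the (M0 (C, D)))"
    using send_messages_summarize[OF 0(1) sub(1)] by simp
  have s1: "dom M0 \<subseteq> dom M" "\<And>C D. (C, D) \<in> dom M \<Longrightarrow> summarizes {} C D (the (M (C, D)))"
    using send_messages_summarize[OF 1(1) sub(2)] s0 by simp_all
  \<comment> \<open>Either the path from \<open>C\<close> to the root passes through
    \<open>D\<close>, or prepending \<open>D\<close> to it gives the path from \<open>D\<close>,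
    which passes through \<open>C\<close>.\<close>
  have "(C, D) \<in> towards J Z \<or> (D, C) \<in> towards J Z"
  proof -
    obtain p where p: "clique_path J C p Z" using path_exists links_cliques[OF assms(2)] Z by blast
    show ?thesis
    proof (cases "D \<in> set p")
      case True
      then show ?thesis using p assms(2) by (auto simp: towards_def)
    next
      case False
      then have "clique_path J D (D # p) Z" using path_Cons[OF links_sym[OF assms(2)] p] by simp
      moreover have "C \<in> set (D # p)" using p by (auto simp: clique_path_def)
      ultimately show ?thesis using links_sym[OF assms(2)] by (auto simp: towards_def simp del: set_simps)
    qed
  qed
  then have "(C, D) \<in> dom M" using 0(2) 1(2) s1(1) by blast
  then show ?thesis by (rule s1(2))
qed

section \<open>Variable propagation\<close>

text \<open>\<open>q\<close> is the part of the path already travelled, and \<open>R\<close> records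
  which messages into the current clique retain \<open>X\<close>. The last premise is the invariant
  that \<open>X\<close> is at hand; the neighbour supplying it must not lie ahead, since the message
  to the next clique leaves out what came from there.\<close>

lemma variable_propagation_summarizes:
  assumes "variable_propagation N J \<epsilon> X p M M'"
    and "clique_path J B (q @ p) A" "X \<in> B" "X \<in> variables N"
    and "\<And>E F. F \<in> set p \<Longrightarrow> E \<in> adj J F \<Longrightarrow>
      summarizes (if F = hd p then R E else {}) E F (the (M (E, F)))"
    and "\<And>E. R E \<subseteq> {X}"
    and "X \<in> hd p \<or> (\<exists>E\<in>adj J (hd p). E \<notin> set p \<and> X \<in> R E \<and> home J X \<in> branch (hd p) E)"
  shows "\<exists>R. (\<forall>E\<in>adj J A. summarizes (R E) E A (the (M' (E, A))) \<and> R E \<subseteq> {X}) \<and>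
    (X \<in> A \<or> (\<exists>E\<in>adj J A. X \<in> R E \<and> home J X \<in> branch A E))"
  using assms
proof (induction arbitrary: q R)
  case (arrived C M)
  have "C = A" using arrived.prems(1) by (simp add: clique_path_def)
  then show ?case using arrived.prems(4-6) by (intro exI[of _ R]) auto
next
  case (forward M C D \<Phi> p M')
  note path = forward.prems(1)
  have dist: "distinct (C # D # p)" and CD: "(C, D) \<in> links J"
    using path by (auto simp: clique_path_def successively_append_iff)
  have old: "summarizes (R E) E C (the (M (E, C)))" if "E \<in> adj J C" for E
    using forward.prems(4)[of C E] that by simp
  have R: "R E \<subseteq> {X}" for E by (rule forward.prems(5))
  have \<Phi>: "summarizes {X} C D \<Phi>"
    by (rule message_summarizes[OF CD forward.hyps(1), where R' = R])
      (use old R forward.prems(6) in auto)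
  \<comment> \<open>At \<open>D\<close> only the recomputed message from \<open>C\<close> retains
    \<open>X\<close>.\<close>
  let ?R = "\<lambda>E. if E = C then {X} else {}"
  show ?case
  proof (rule forward.IH[where q = "q @ [C]" and R = ?R])
    show "clique_path J B ((q @ [C]) @ D # p) A" using path by simp
    show "summarizes (if F = hd (D # p) then ?R E else {}) E F (the ((M((C, D) \<mapsto> \<Phi>)) (E, F)))"
      if "F \<in> set (D # p)" "E \<in> adj J F" for E F
    proof -
      have "F \<noteq> C" using that(1) dist by force
      then have "summarizes {} E F (the (M (E, F)))"
        using forward.prems(4)[of F E] that by simp
      moreover have "F \<noteq> D" if "F \<in> set p" using that dist by force
      ultimately show ?thesis
        using \<Phi> that(1) by (cases "F = D"; cases "E = C") simp_all
    qed
    show "X \<in> hd (D # p) \<or> (\<exists>E\<in>adj J (hd (D # p)). E \<notin> set (D # p) \<and> X \<in> ?R E \<and>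
        home J X \<in> branch (hd (D # p)) E)"
    proof (cases "X \<in> D")
      \<comment> \<open>\<open>B\<close> lies behind \<open>C\<close> as seen from \<open>D\<close>.
        Were the home of \<open>X\<close> in another branch, \<open>D\<close> would separate two
        cliques containing \<open>X\<close> and so contain it too. Hence the home lies in the branch
        summarized by the new message.\<close>
      case False
      have "clique_path J B (q @ C # [D]) D"
        using path_prefix[of B "q @ [C]" D p A] path by simp
      then have "clique_path J D (D # C # rev q) B" using path_rev by fastforce
      then have B: "B \<in> branch D C" by (auto simp: branch_def)
      have h: "home J X \<noteq> D" using homed_mem[OF forward.prems(3)] False by auto
      obtain E where E: "E \<in> adj J D" "home J X \<in> branch D E"
        using branch_cover[OF _ home_clique[OF forward.prems(3)] h] links_cliques[OF CD] by blast
      have "E = C"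
      proof (rule ccontr)
        assume "E \<noteq> C"
        then show False
          using separator_branches[OF B E(2) _ forward.prems(2) homed_mem[OF forward.prems(3)]] False
          by simp
      qed
      then show ?thesis using E dist by auto
    qed simp
  qed (use forward.prems(2,3) in auto)
qed

section \<open>The clique potential at the receiving clique\<close>

lemma cliques_eq: "C \<in> cliques J \<Longrightarrow> cliques J = insert C (\<Union>E\<in>adj J C. branch C E)"
proof (intro equalityI subsetI)
  fix F assume "F \<in> insert C (\<Union>E\<in>adj J C. branch C E)" and "C \<in> cliques J"
  then show "F \<in> cliques J" by (auto simp: branch_def dest: path_cliques)
next
  fix F assume "C \<in> cliques J" "F \<in> cliques J"
  then show "F \<in> insert C (\<Union>E\<in>adj J C. branch C E)"
    using branch_cover[of C F] by blast
qed

text \<open>Soundness for the set of all owners gives the product of the probability potentials; the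
  evidence functions, one for each variable of \<open>?W\<close>, supply the constants and the zeros
  at contradicted evidence.\<close>

lemma joint_potential_clique:
  assumes A: "A \<in> cliques J" and X: "X \<in> variables N"
    and msgs: "\<And>E. E \<in> adj J A \<Longrightarrow> summarizes (R E) E A (the (M (E, A)))"
    and R: "\<And>E. E \<in> adj J A \<Longrightarrow> R E \<subseteq> {X}"
    and XR: "X \<in> A \<or> (\<exists>E\<in>adj J A. X \<in> R E \<and> home J X \<in> branch A E)"
  shows "joint_potential N \<epsilon> (A \<union> {X}) (clique_potential N J \<epsilon> M A)"
proof -
  let ?\<Phi> = "combined N J \<epsilon> M A (adj J A)" and ?W = "A \<union> {X}"
  let ?e = "\<lambda>Y. Evid Y (evidence_function N \<epsilon> Y)"
  note comb = wf_combined[where R = R, OF subset_refl A msgs]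
    owners_combined[where R = R, OF subset_refl A msgs]
    owners_combined_kept[where R = R, OF subset_refl A msgs]
    sound_combined[where R = R, OF subset_refl A msgs]
    domain_combined[where R = R, OF subset_refl A msgs]
    evid_combined[where R = R, OF subset_refl A msgs]
    owners_combined_branch[where R = R, OF subset_refl A msgs]
  have all: "homed (insert A (\<Union>E\<in>adj J A. branch A E)) = variables N"
    using home_clique cliques_eq[OF A] by (auto simp: homed_def)
  have WN: "?W \<subseteq> variables N" using clique_subset[OF A] X by auto
  have finW: "finite ?W" using WN fin_vars by (rule finite_subset)
  have dom: "domain \<phi> \<subseteq> ?W" if "\<phi> \<in> ?\<Phi>" for \<phi>
    using comb(5)[OF _ that] R by blast
  have wf: "wf_potential ?\<Phi>" using comb(1) by simp
  have sound: "sound ?\<Phi>"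
    using comb(4)[of "{}"] sound_cpds all by (simp add: wf_potential_def)
  have owners: "owners ?\<Phi> = ?W \<union> dom \<epsilon>"
  proof (intro equalityI subsetI)
    \<comment> \<open>An owner that keeps its head lies in the domain, hence in \<open>?W\<close>;
      one that has lost it is observed.\<close>
    fix Y assume "Y \<in> owners ?\<Phi>"
    then obtain H T g where "Prob Y H T g \<in> ?\<Phi>"
      by (auto simp: owners_def probs_def elim!: is_prob.elims)
    moreover from this have "wf_factor (Prob Y H T g)"
      using wf unfolding wf_potential_def by blast
    ultimately show "Y \<in> ?W \<union> dom \<epsilon>" using dom[of "Prob Y H T g"] by auto
  next
    fix Y assume Y: "Y \<in> ?W \<union> dom \<epsilon>"
    then have YN: "Y \<in> variables N" using WN ev by (auto simp: hard_evidence_def)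
    show "Y \<in> owners ?\<Phi>"
    proof (cases "Y \<in> A \<or> Y \<in> dom \<epsilon>")
      case True
      then show ?thesis using comb(3)[of Y] YN all by simp
    next
      case False
      then obtain E where "E \<in> adj J A" "Y \<in> R E" "Y \<in> homed (branch A E)"
        using XR Y YN by (auto simp: homed_def)
      then show ?thesis using comb(7)[of E] by blast
    qed
  qed
  have anc: "ancestral ?\<Phi> (owners ?\<Phi>)"
    unfolding ancestral_def
  proof (intro conjI ballI impI)
    show "tail \<phi> \<subseteq> owners ?\<Phi>" if "\<phi> \<in> probs ?\<Phi>" for \<phi>
      using dom[of \<phi>] that unfolding owners probs_def by (cases \<phi>) auto
  qed (use owners in auto)
  \<comment> \<open>Copies of one evidence function arriving from several cliques are the same
    element of the set.\<close>
  have evids: "{\<phi> \<in> ?\<Phi>. \<not> is_prob \<phi>} = ?e ` ?W"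
  proof (intro equalityI subsetI)
    fix \<phi> assume "\<phi> \<in> {\<phi> \<in> ?\<Phi>. \<not> is_prob \<phi>}"
    then obtain Y g where \<phi>: "\<phi> = Evid Y g" "\<phi> \<in> ?\<Phi>" by (auto elim: is_prob.elims)
    then have "wf_factor \<phi>" using wf by (auto simp: wf_potential_def)
    then show "\<phi> \<in> ?e ` ?W" using \<phi> dom[of \<phi>] by auto
  next
    fix \<phi> assume "\<phi> \<in> ?e ` ?W"
    then obtain Y where Y: "Y \<in> ?W" "\<phi> = ?e Y" by blast
    have "?e Y \<in> ?\<Phi>" by (rule comb(6)) (use Y(1) XR in auto)
    then show "\<phi> \<in> {\<phi> \<in> ?\<Phi>. \<not> is_prob \<phi>}" using Y(2) by simp
  qed
  have split: "contraction ?\<Phi> w = (\<Prod>\<phi>\<in>probs ?\<Phi>. val \<phi> w) * (\<Prod>Y\<in>?W. evidence_function N \<epsilon> Y w)" for w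
  proof -
    have "inj_on ?e ?W" by (auto simp: inj_on_def)
    then have "(\<Prod>\<phi>\<in>?e ` ?W. val \<phi> w) = (\<Prod>Y\<in>?W. evidence_function N \<epsilon> Y w)"
      by (subst prod.reindex) simp_all
    moreover have "finite ?\<Phi>" using wf by (simp add: wf_potential_def)
    then have "contraction ?\<Phi> w = (\<Prod>\<phi>\<in>probs ?\<Phi>. val \<phi> w) * (\<Prod>\<phi>\<in>{\<phi> \<in> ?\<Phi>. \<not> is_prob \<phi>}. val \<phi> w)"
      unfolding contraction_def probs_def by (subst prod.union_disjoint[symmetric]) (auto intro!: prod.cong)
    ultimately show ?thesis unfolding evids by simp
  qed
  have "contraction ?\<Phi> w =
      joint_prob N \<epsilon> ?W w * (\<Prod>Y\<in>{Y \<in> ?W. \<epsilon> Y = None}. 1 / real (card (states N Y)))"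
    if w: "w \<in> configs N" for w
  proof (cases "\<forall>Y\<in>?W. \<forall>y. \<epsilon> Y = Some y \<longrightarrow> w Y = y")
    \<comment> \<open>Both sides vanish: one evidence function is 0, and no completion of
      \<open>w\<close> respects the evidence.\<close>
    case False
    then obtain Y y where Y: "Y \<in> ?W" "\<epsilon> Y = Some y" "w Y \<noteq> y" by blast
    then have "evidence_function N \<epsilon> Y w = 0" by (simp add: evidence_function_def)
    then have "(\<Prod>Y\<in>?W. evidence_function N \<epsilon> Y w) = 0" using finW Y(1) by (intro prod_zero) blast+
    moreover have none: "{v \<in> Pi\<^sub>E (variables N) (states N).
        (\<forall>Y\<in>?W. v Y = w Y) \<and> (\<forall>Y y. \<epsilon> Y = Some y \<longrightarrow> v Y = y)} = {}"
    proof (rule equals0I)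
      fix v assume "v \<in> {v \<in> Pi\<^sub>E (variables N) (states N).
        (\<forall>Y\<in>?W. v Y = w Y) \<and> (\<forall>Y y. \<epsilon> Y = Some y \<longrightarrow> v Y = y)}"
      then have "\<forall>Y\<in>?W. v Y = w Y" "\<forall>Y y. \<epsilon> Y = Some y \<longrightarrow> v Y = y" by simp_all
      from this(1)[rule_format, OF Y(1)] this(2)[rule_format, OF Y(2)] show False
        using Y(3) by simp
    qed
    have "joint_prob N \<epsilon> ?W w = 0" unfolding joint_prob_def none by simp
    ultimately show ?thesis unfolding split by simp
  next
    case True
    \<comment> \<open>Soundness speaks of \<open>econfigs\<close>, but \<open>w\<close> may
      contradict the evidence outside \<open>?W\<close>. Overriding it there changes no factor, as
      all domains lie in \<open>?W\<close>.\<close>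
    define w' where "w' = (\<lambda>Y. case \<epsilon> Y of Some y \<Rightarrow> y | None \<Rightarrow> w Y)"
    have ww': "w' Y = w Y" if "Y \<in> ?W" for Y
      using True that by (auto simp: w'_def split: option.split)
    have w': "w' \<in> econfigs"
      using w ev by (auto simp: econfigs_def configs_def w'_def hard_evidence_def split: option.split)
    have "(\<Prod>\<phi>\<in>probs ?\<Phi>. val \<phi> w) = (\<Prod>\<phi>\<in>probs ?\<Phi>. val \<phi> w')"
    proof (rule prod.cong)
      fix \<phi> assume "\<phi> \<in> probs ?\<Phi>"
      then have \<phi>: "\<phi> \<in> ?\<Phi>" by (simp add: probs_def)
      then have "wf_factor \<phi>" using wf by (simp add: wf_potential_def)
      from wf_depends[OF this] show "val \<phi> w = val \<phi> w'"
        by (rule depends_only_onD) (use dom[OF \<phi>] ww' in auto)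
    qed simp
    also have "\<dots> = owned_prod (owners ?\<Phi>) ?\<Phi> w'"
      unfolding owned_prod_def by (rule prod.cong) (auto simp: owners_def)
    also have "\<dots> = joint_prob N \<epsilon> (owners ?\<Phi>) w'"
      using sound anc w' by (simp add: sound_def)
    also have "\<dots> = joint_prob N \<epsilon> ?W w"
    proof -
      \<comment> \<open>The owners outside \<open>?W\<close> are observed, and there
        \<open>w'\<close> prescribes only what the evidence already does.\<close>
      have eq: "(\<forall>Y\<in>owners ?\<Phi>. v Y = w' Y) \<longleftrightarrow> (\<forall>Y\<in>?W. v Y = w Y)"
        if "\<forall>Y y. \<epsilon> Y = Some y \<longrightarrow> v Y = y" for v
      proof -
        have "v Y = w' Y" if "Y \<in> dom \<epsilon>" for Y
          using \<open>\<forall>Y y. \<epsilon> Y = Some y \<longrightarrow> v Y = y\<close> that by (auto simp: w'_def)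
        then have "(\<forall>Y\<in>owners ?\<Phi>. v Y = w' Y) \<longleftrightarrow> (\<forall>Y\<in>?W. v Y = w' Y)"
          unfolding owners by blast
        then show ?thesis using ww' by simp
      qed
      have "{v \<in> Pi\<^sub>E (variables N) (states N).
          (\<forall>Y\<in>owners ?\<Phi>. v Y = w' Y) \<and> (\<forall>Y y. \<epsilon> Y = Some y \<longrightarrow> v Y = y)} =
        {v \<in> Pi\<^sub>E (variables N) (states N).
          (\<forall>Y\<in>?W. v Y = w Y) \<and> (\<forall>Y y. \<epsilon> Y = Some y \<longrightarrow> v Y = y)}"
      proof (rule Collect_cong)
        fix v
        show "(v \<in> Pi\<^sub>E (variables N) (states N) \<and>
            (\<forall>Y\<in>owners ?\<Phi>. v Y = w' Y) \<and> (\<forall>Y y. \<epsilon> Y = Some y \<longrightarrow> v Y = y)) \<longleftrightarrow>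
          (v \<in> Pi\<^sub>E (variables N) (states N) \<and>
            (\<forall>Y\<in>?W. v Y = w Y) \<and> (\<forall>Y y. \<epsilon> Y = Some y \<longrightarrow> v Y = y))"
          using eq[of v] by argo
      qed
      then show ?thesis by (simp only: joint_prob_def)
    qed
    finally have P: "(\<Prod>\<phi>\<in>probs ?\<Phi>. val \<phi> w) = joint_prob N \<epsilon> ?W w" .
    have "(\<Prod>Y\<in>?W. evidence_function N \<epsilon> Y w) =
        (\<Prod>Y\<in>?W. if \<epsilon> Y = None then 1 / real (card (states N Y)) else 1)"
      using True by (intro prod.cong) (auto simp: evidence_function_def split: option.split)
    also have "\<dots> = (\<Prod>Y\<in>{Y \<in> ?W. \<epsilon> Y = None}. 1 / real (card (states N Y)))"
      by (rule prod.inter_filter[OF finW, symmetric])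
    finally show ?thesis unfolding split P by simp
  qed
  moreover have "potential_on N ?W ?\<Phi>"
    unfolding potential_on_def
  proof (intro conjI ballI)
    show "finite ?\<Phi>" using wf by (simp add: wf_potential_def)
    fix \<phi> assume \<phi>: "\<phi> \<in> ?\<Phi>"
    then have "wf_factor \<phi>" using wf by (simp add: wf_potential_def)
    then show "depends_only_on (domain \<phi>) (val \<phi>)" "\<And>w. w \<in> configs N \<Longrightarrow> 0 \<le> val \<phi> w"
      using wf_depends wf_nonneg by auto
    show "domain \<phi> \<subseteq> ?W" by (rule dom[OF \<phi>])
  qed
  ultimately show ?thesis
    by (simp add: joint_potential_def clique_potential_def)
qed

end

theorem theorem6p1:
  fixes N :: "('v, 's) bayes_net" and J :: "'v jtree" and \<epsilon> :: "'v \<rightharpoonup> 's"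
    and M M' :: "('v, 's) messages" and A B :: "'v set" and X :: 'v and p :: "'v set list"
  assumes "bayesian_network N"
    and "hard_evidence N \<epsilon>"
    and "junction_tree N J"
    and "fully_propagated N J \<epsilon> M"
    and "A \<in> cliques J" and "B \<in> cliques J"
    and "X \<in> variables N" and "X \<notin> A" and "X \<in> B"
    and "clique_path J B p A"
    and "variable_propagation N J \<epsilon> X p M M'"
  shows "joint_potential N \<epsilon> (A \<union> {X}) (clique_potential N J \<epsilon> M' A)"
proof -
  interpret junction N \<epsilon> J
    by unfold_locales (use assms in auto)
  have hd: "hd p = B" using assms(10) by (simp add: clique_path_def)
  have "\<exists>R. (\<forall>E\<in>adj J A. summarizes (R E) E A (the (M' (E, A))) \<and> R E \<subseteq> {X}) \<and>
    (X \<in> A \<or> (\<exists>E\<in>adj J A. X \<in> R E \<and> home J X \<in> branch A E))"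
  \<comment> \<open>Before the first recomputation no message retains an additional variable, and
    \<open>X\<close> is at hand because it belongs to \<open>B\<close>.\<close>
  proof (rule variable_propagation_summarizes[OF assms(11), where B = B and q = "[]" and R = "\<lambda>_. {}"])
    show "summarizes (if F = hd p then {} else {}) E F (the (M (E, F)))"
      if "F \<in> set p" "E \<in> adj J F" for E F
      using fully_propagated_summarizes[OF assms(4)] links_sym that(2) by (auto simp: adj_def)
  qed (use assms hd in auto)
  then obtain R where "\<forall>E\<in>adj J A. summarizes (R E) E A (the (M' (E, A))) \<and> R E \<subseteq> {X}"
    "X \<in> A \<or> (\<exists>E\<in>adj J A. X \<in> R E \<and> home J X \<in> branch A E)" by blast
  then show ?thesis
    using joint_potential_clique[OF assms(5,7)] by blast
qed

end
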